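(* Let $d\ge 1$ and let $\{(R_j,B_j,L_j):j\ge1\}$ be a frame tower (with $R_j$ expanding $d\times d$ integer matrices and $B_j,L_j\subset\mathbb{Z}^d$ finite sets containing $0$) whose associated infinite convolution measure $\mu=\mu(\{R_j,B_j\})$ satisfies the no-overlap condition. Let $\Lambda_n=L_1+R_1^{\mathtt T}L_2+\cdots+(R_1^{\mathtt T}R_2^{\mathtt T}\cdots R_{n-1}^{\mathtt T})L_n$ and $\Lambda=\bigcup_{n\ge1}\Lambda_n$, and suppose that $$\delta(\Lambda)=\inf_{n\ge 1}\inf_{\lambda\in\Lambda_n}|\widehat{\mu_{>n}}(\lambda)|^2>0.$$ Then: (i) If $\#B_j=\#L_j$ for all $j$, then $E(\Lambda)=\{e^{2\pi i\langle\lambda,x\rangle}:\lambda\in\Lambda\}$ is a Riesz basis for $L^2(\mu)$. (ii) If there exists $j$ such that $\#B_j<\#L_j$, then $\{e^{2\pi i\langle\lambda,x\rangle}:\lambda\in\Lambda\}$ is a frame for $L^2(\mu)$ with infinite redundancies, i.e. there exists an infinite subset $\Lambda_0$ of $\Lambda$ such that $\{e^{2\pi i\langle\lambda,x\rangle}:\lambda\in\Lambda\setminus\Lambda_0\}$ is still a frame for $L^2(\mu)$.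
   Context: A square matrix is expanding if all its eigenvalues have modulus $>1$. $A^{\mathtt T}$ denotes the transpose. Frame for a Hilbert space $H$: a collection $\{f_k\}$ for which there are $C,D>0$ with $C\|x\|^2\le\sum_k|\langle x,f_k\rangle|^2\le D\|x\|^2$ for all $x\in H$. Riesz sequence: there are $C,D>0$ with $C\sum|a_k|^2\le\|\sum a_kf_k\|^2\le D\sum|a_k|^2$ for all finitely supported scalar sequences $(a_k)$. Riesz basis: both a frame and a Riesz sequence. Towers. For an expanding integer matrix $R$ and finite $B,L\subset\mathbb{Z}^d$ with $0\in B\cap L$, put $\mathbf{e}_{R,\lambda}=\frac{1}{\sqrt{\#B}}\big(e^{2\pi i\langle R^{-1}b,\lambda\rangle}\big)_{b\in B}\in\mathbb{C}^{\#B}$. $(R,B,L)$ is a frame triple with bounds $C\le D$ if $C\|\mathbf{x}\|^2\le\sum_{\lambda\in L}|\langle\mathbf{x},\mathbf{e}_{R,\lambda}\rangle|^2\le D\|\mathbf{x}\|^2$ for all $\mathbf{x}\in\mathbb{C}^{\#B}$. $\{(R_j,B_j,L_j)\}_{j\ge1}$ is a frame tower if there are $0<C_j\le D_j<\infty$ with $\prod_j C_j>0$ and $\prod_j D_j<\infty$ such that each $(R_j,B_j,L_j)$ is a frame triple with bounds $C_j,D_j$. Measure. $\mathbf{R}_n=R_nR_{n-1}\cdots R_1$; for a finite set $A$, $\delta_A=\frac{1}{\#A}\sum_{a\in A}\delta_a$ ($\delta_a$ the Dirac mass at $a$). $\mu=\delta_{\mathbf{R}_1^{-1}B_1}*\delta_{\mathbf{R}_2^{-1}B_2}*\cdots$,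 the infinite convolution being assumed to converge weakly to a Borel probability measure. $\mu_{>n}=\delta_{\mathbf{R}_{n+1}^{-1}B_{n+1}}*\delta_{\mathbf{R}_{n+2}^{-1}B_{n+2}}*\cdots$. $\mathbf{B}_n=\mathbf{R}_n\{\sum_{k=1}^n\mathbf{R}_k^{-1}b_k:b_k\in B_k\}$ and $K_n=\{\sum_{k=n+1}^\infty\mathbf{R}_k^{-1}b_k:b_k\in B_k\}$ (these series being assumed to converge). No-overlap condition: $\mu\big((\mathbf{R}_n^{-1}\mathbf{b}+K_n)\cap(\mathbf{R}_n^{-1}\mathbf{b}'+K_n)\big)=0$ for all $\mathbf{b}\ne\mathbf{b}'$ in $\mathbf{B}_n$ and all $n\ge1$. Fourier transform: $\widehat{\nu}(y)=\int e^{-2\pi i\langle y,x\rangle}d\nu(x)$. Frequencies. $\Lambda_n$ is the sumset displayed in the claim, a subset of $\mathbb{Z}^d$, and $\Lambda$ is the union of these sets.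
   Formalization: In (ii), the existence of the infinite Λ_0 is stated only when Λ is infinite and each element of each Λ_n has a unique representation l_1+R_1^T l_2+… with l_k in L_k; without these it can fail. (i) and the frame claim in (ii) are unchanged. *)

theory Defs
  imports "HOL-Probability.Probability"
begin

section \<open>Integer vectors and matrices\<close>

definition rvec :: "int ^ 'n \<Rightarrow> real ^ 'n"
  where "rvec v = (\<chi> i. real_of_int (v $ i))"

definition rmat :: "int ^ 'n ^ 'n \<Rightarrow> real ^ 'n ^ 'n"
  where "rmat M = map_matrix real_of_int M"

definition expanding :: "int ^ 'n ^ 'n \<Rightarrow> bool"
  where "expanding M \<longleftrightarrow>
    (\<forall>(z::complex) (v::complex ^ 'n). v \<noteq> 0 \<longrightarrow> map_matrix of_int M *v v = z *s v \<longrightarrow> cmod z > 1)"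


section \<open>Frame triples and frame towers\<close>

definition triple_vec :: "int ^ 'n ^ 'n \<Rightarrow> (int ^ 'n) set \<Rightarrow> int ^ 'n \<Rightarrow> int ^ 'n \<Rightarrow> complex"
  where "triple_vec R B l b =
    of_real (1 / sqrt (card B)) * cis (2 * pi * ((matrix_inv (rmat R) *v rvec b) \<bullet> rvec l))"

text \<open>Vectors of the complex space of dimension \<open>#B\<close> are functions on \<open>B\<close>; their values off \<open>B\<close>
  are irrelevant.\<close>

definition frame_triple ::
    "int ^ 'n ^ 'n \<Rightarrow> (int ^ 'n) set \<Rightarrow> (int ^ 'n) set \<Rightarrow> real \<Rightarrow> real \<Rightarrow> bool"
  where "frame_triple R B L C D \<longleftrightarrow>
    expanding R \<and> finite B \<and> finite L \<and> 0 \<in> B \<inter> L \<and> C \<le> D \<and>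
    (\<forall>x :: int ^ 'n \<Rightarrow> complex.
        C * (\<Sum>b\<in>B. (cmod (x b))\<^sup>2)
          \<le> (\<Sum>l\<in>L. (cmod (\<Sum>b\<in>B. x b * cnj (triple_vec R B l b)))\<^sup>2) \<and>
        (\<Sum>l\<in>L. (cmod (\<Sum>b\<in>B. x b * cnj (triple_vec R B l b)))\<^sup>2)
          \<le> D * (\<Sum>b\<in>B. (cmod (x b))\<^sup>2))"

text \<open>Sequences are indexed by \<open>j \<ge> 1\<close>; their values at 0 are never used.
  \<^const>\<open>convergent_prod\<close> additionally requires a nonzero limit. For \<open>D\<close> this is no restriction:
  testing the upper frame bound on the unit vector of the frequency \<open>0 \<in> L j\<close> gives \<open>D j \<ge> 1\<close>.\<close>

definition frame_tower ::
    "(nat \<Rightarrow> int ^ 'n ^ 'n) \<Rightarrow> (nat \<Rightarrow> (int ^ 'n) set) \<Rightarrow> (nat \<Rightarrow> (int ^ 'n) set) \<Rightarrow> bool"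
  where "frame_tower R B L \<longleftrightarrow>
    (\<exists>C D. (\<forall>j\<ge>1. 0 < C j \<and> C j \<le> D j \<and> frame_triple (R j) (B j) (L j) (C j) (D j)) \<and>
           convergent_prod (\<lambda>j. C (Suc j)) \<and> 0 < (\<Prod>j. C (Suc j)) \<and>
           convergent_prod (\<lambda>j. D (Suc j)))"

text \<open>\<open>cum_mat R n\<close> is the product \<open>R n ** \<dots> ** R 1\<close>, so that \<open>transpose (cum_mat R n)\<close> is
  \<open>transpose (R 1) ** \<dots> ** transpose (R n)\<close>.\<close>

primrec cum_mat :: "(nat \<Rightarrow> int ^ 'n ^ 'n) \<Rightarrow> nat \<Rightarrow> int ^ 'n ^ 'n"
  where
    "cum_mat R 0 = mat 1"
  | "cum_mat R (Suc n) = R (Suc n) ** cum_mat R n"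

definition cum_inv :: "(nat \<Rightarrow> int ^ 'n ^ 'n) \<Rightarrow> nat \<Rightarrow> int ^ 'n \<Rightarrow> real ^ 'n"
  where "cum_inv R n b = matrix_inv (rmat (cum_mat R n)) *v rvec b"


section \<open>Infinite convolutions\<close>

definition unif_dirac :: "(real ^ 'n) set \<Rightarrow> (real ^ 'n) measure"
  where "unif_dirac A = distr (measure_pmf (pmf_of_set A)) borel (\<lambda>x. x)"

text \<open>The start value, the Dirac mass at 0, is neutral for convolution.\<close>

primrec fin_convolution :: "(nat \<Rightarrow> (real ^ 'n) measure) \<Rightarrow> nat \<Rightarrow> (real ^ 'n) measure"
  where
    "fin_convolution \<nu> 0 = return borel 0"
  | "fin_convolution \<nu> (Suc n) = (fin_convolution \<nu> n \<star> \<nu> n)"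

definition weakly_converges :: "(nat \<Rightarrow> 'a::topological_space measure) \<Rightarrow> 'a measure \<Rightarrow> bool"
  where "weakly_converges M N \<longleftrightarrow>
    (\<forall>f :: 'a \<Rightarrow> real. continuous_on UNIV f \<longrightarrow> bounded (range f) \<longrightarrow>
        (\<lambda>n. integral\<^sup>L (M n) f) \<longlonglongrightarrow> integral\<^sup>L N f)"

definition is_inf_convolution :: "(nat \<Rightarrow> (real ^ 'n) measure) \<Rightarrow> (real ^ 'n) measure \<Rightarrow> bool"
  where "is_inf_convolution \<nu> N \<longleftrightarrow>
    prob_space N \<and> sets N = sets borel \<and> weakly_converges (fin_convolution \<nu>) N"

definition inf_convolution :: "(nat \<Rightarrow> (real ^ 'n) measure) \<Rightarrow> (real ^ 'n) measure"
  where "inf_convolution \<nu> = (THE N. is_inf_convolution \<nu> N)"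

text \<open>The convolution factors with index \<open>> n\<close>; \<open>tower_tail R B n\<close> is the measure
  \<open>\<mu>\<close> with subscript \<open>> n\<close>, and \<open>tower_measure R B\<close> is \<open>\<mu>\<close> itself.\<close>

definition tower_factors ::
    "(nat \<Rightarrow> int ^ 'n ^ 'n) \<Rightarrow> (nat \<Rightarrow> (int ^ 'n) set) \<Rightarrow> nat \<Rightarrow> nat \<Rightarrow> (real ^ 'n) measure"
  where "tower_factors R B n k = unif_dirac (cum_inv R (n + k + 1) ` B (n + k + 1))"

definition tower_tail ::
    "(nat \<Rightarrow> int ^ 'n ^ 'n) \<Rightarrow> (nat \<Rightarrow> (int ^ 'n) set) \<Rightarrow> nat \<Rightarrow> (real ^ 'n) measure"
  where "tower_tail R B n = inf_convolution (tower_factors R B n)"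

definition tower_measure ::
    "(nat \<Rightarrow> int ^ 'n ^ 'n) \<Rightarrow> (nat \<Rightarrow> (int ^ 'n) set) \<Rightarrow> (real ^ 'n) measure"
  where "tower_measure R B = tower_tail R B 0"

definition tower_series_converge ::
    "(nat \<Rightarrow> int ^ 'n ^ 'n) \<Rightarrow> (nat \<Rightarrow> (int ^ 'n) set) \<Rightarrow> bool"
  where "tower_series_converge R B \<longleftrightarrow>
    (\<forall>b. (\<forall>k\<ge>1. b k \<in> B k) \<longrightarrow> summable (\<lambda>k. cum_inv R (k + 1) (b (k + 1))))"

definition tower_digits ::
    "(nat \<Rightarrow> int ^ 'n ^ 'n) \<Rightarrow> (nat \<Rightarrow> (int ^ 'n) set) \<Rightarrow> nat \<Rightarrow> (real ^ 'n) set"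
  where "tower_digits R B n =
    {rmat (cum_mat R n) *v (\<Sum>k=1..n. cum_inv R k (b k)) | b. \<forall>k\<in>{1..n}. b k \<in> B k}"

definition tower_K ::
    "(nat \<Rightarrow> int ^ 'n ^ 'n) \<Rightarrow> (nat \<Rightarrow> (int ^ 'n) set) \<Rightarrow> nat \<Rightarrow> (real ^ 'n) set"
  where "tower_K R B n =
    {(\<Sum>k. cum_inv R (n + k + 1) (b (n + k + 1))) | b. \<forall>k>n. b k \<in> B k}"

definition tower_cell ::
    "(nat \<Rightarrow> int ^ 'n ^ 'n) \<Rightarrow> (nat \<Rightarrow> (int ^ 'n) set) \<Rightarrow> nat \<Rightarrow> real ^ 'n \<Rightarrow> (real ^ 'n) set"
  where "tower_cell R B n b = (\<lambda>x. matrix_inv (rmat (cum_mat R n)) *v b + x) ` tower_K R B n"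

definition no_overlap :: "(nat \<Rightarrow> int ^ 'n ^ 'n) \<Rightarrow> (nat \<Rightarrow> (int ^ 'n) set) \<Rightarrow> bool"
  where "no_overlap R B \<longleftrightarrow>
    (\<forall>n\<ge>1. \<forall>b\<in>tower_digits R B n. \<forall>b'\<in>tower_digits R B n. b \<noteq> b' \<longrightarrow>
        emeasure (tower_measure R B) (tower_cell R B n b \<inter> tower_cell R B n b') = 0)"


section \<open>Frequencies\<close>

definition freq_sum :: "(nat \<Rightarrow> int ^ 'n ^ 'n) \<Rightarrow> nat \<Rightarrow> (nat \<Rightarrow> int ^ 'n) \<Rightarrow> int ^ 'n"
  where "freq_sum R n l = (\<Sum>k=1..n. transpose (cum_mat R (k - 1)) *v l k)"

definition Lambda_n ::
    "(nat \<Rightarrow> int ^ 'n ^ 'n) \<Rightarrow> (nat \<Rightarrow> (int ^ 'n) set) \<Rightarrow> nat \<Rightarrow> (int ^ 'n) set"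
  where "Lambda_n R L n = freq_sum R n ` (\<Pi>\<^sub>E k\<in>{1..n}. L k)"

definition Lambda ::
    "(nat \<Rightarrow> int ^ 'n ^ 'n) \<Rightarrow> (nat \<Rightarrow> (int ^ 'n) set) \<Rightarrow> (int ^ 'n) set"
  where "Lambda R L = (\<Union>n\<in>{1..}. Lambda_n R L n)"

text \<open>Frequencies are a set, so a frame triple that is redundant only through congruent frequencies
  need not make \<open>Lambda\<close> redundant. Example in dimension 1: \<open>R j = 2\<close>, \<open>B j = {0, 1}\<close>,
  \<open>L 1 = {-1, 0, 1}\<close>, \<open>L j = {0, 1}\<close> for the other odd \<open>j\<close>, \<open>L j = {0, -1}\<close> for even \<open>j\<close>. Then
  \<open>Lambda\<close> is the set of all integers and the measure is Lebesgue measure on the unit interval, so the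
  exponentials form an orthonormal basis. Unique representations exclude this.\<close>

definition direct_freqs :: "(nat \<Rightarrow> int ^ 'n ^ 'n) \<Rightarrow> (nat \<Rightarrow> (int ^ 'n) set) \<Rightarrow> bool"
  where "direct_freqs R L \<longleftrightarrow> (\<forall>n\<ge>1. inj_on (freq_sum R n) (\<Pi>\<^sub>E k\<in>{1..n}. L k))"

definition fourier :: "(real ^ 'n) measure \<Rightarrow> real ^ 'n \<Rightarrow> complex"
  where "fourier \<nu> y = (\<integral>x. cis (- 2 * pi * (y \<bullet> x)) \<partial>\<nu>)"

definition delta_Lambda ::
    "(nat \<Rightarrow> int ^ 'n ^ 'n) \<Rightarrow> (nat \<Rightarrow> (int ^ 'n) set) \<Rightarrow> (nat \<Rightarrow> (int ^ 'n) set) \<Rightarrow> real"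
  where "delta_Lambda R B L =
    (INF n\<in>{1..}. INF l\<in>Lambda_n R L n. (cmod (fourier (tower_tail R B n) (rvec l)))\<^sup>2)"


section \<open>Frames and Riesz bases in the L2 space of a measure\<close>

text \<open>Elements of L2 are represented by functions; none of the notions below distinguishes functions
  that agree almost everywhere. Collections are families \<open>(e k)\<close> with \<open>k \<in> I\<close>.\<close>

definition L2 :: "'a measure \<Rightarrow> ('a \<Rightarrow> complex) set"
  where "L2 M = {f. f \<in> borel_measurable M \<and> integrable M (\<lambda>x. (cmod (f x))\<^sup>2)}"

definition L2_inner :: "'a measure \<Rightarrow> ('a \<Rightarrow> complex) \<Rightarrow> ('a \<Rightarrow> complex) \<Rightarrow> complex"
  where "L2_inner M f g = (\<integral>x. f x * cnj (g x) \<partial>M)"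

definition L2_norm_sq :: "'a measure \<Rightarrow> ('a \<Rightarrow> complex) \<Rightarrow> real"
  where "L2_norm_sq M f = (\<integral>x. (cmod (f x))\<^sup>2 \<partial>M)"

definition L2_frame :: "'a measure \<Rightarrow> 'i set \<Rightarrow> ('i \<Rightarrow> 'a \<Rightarrow> complex) \<Rightarrow> bool"
  where "L2_frame M I e \<longleftrightarrow>
    (\<forall>k\<in>I. e k \<in> L2 M) \<and>
    (\<exists>C>0. \<exists>D>0. \<forall>f\<in>L2 M.
        (\<lambda>k. (cmod (L2_inner M f (e k)))\<^sup>2) summable_on I \<and>
        C * L2_norm_sq M f \<le> (\<Sum>\<^sub>\<infinity>k\<in>I. (cmod (L2_inner M f (e k)))\<^sup>2) \<and>
        (\<Sum>\<^sub>\<infinity>k\<in>I. (cmod (L2_inner M f (e k)))\<^sup>2) \<le> D * L2_norm_sq M f)"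

definition L2_riesz_sequence :: "'a measure \<Rightarrow> 'i set \<Rightarrow> ('i \<Rightarrow> 'a \<Rightarrow> complex) \<Rightarrow> bool"
  where "L2_riesz_sequence M I e \<longleftrightarrow>
    (\<forall>k\<in>I. e k \<in> L2 M) \<and>
    (\<exists>C>0. \<exists>D>0. \<forall>F a. finite F \<longrightarrow> F \<subseteq> I \<longrightarrow>
        C * (\<Sum>k\<in>F. (cmod (a k))\<^sup>2) \<le> L2_norm_sq M (\<lambda>x. \<Sum>k\<in>F. a k * e k x) \<and>
        L2_norm_sq M (\<lambda>x. \<Sum>k\<in>F. a k * e k x) \<le> D * (\<Sum>k\<in>F. (cmod (a k))\<^sup>2))"

definition L2_riesz_basis :: "'a measure \<Rightarrow> 'i set \<Rightarrow> ('i \<Rightarrow> 'a \<Rightarrow> complex) \<Rightarrow> bool"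
  where "L2_riesz_basis M I e \<longleftrightarrow> L2_frame M I e \<and> L2_riesz_sequence M I e"

definition expo :: "int ^ 'n \<Rightarrow> real ^ 'n \<Rightarrow> complex"
  where "expo l x = cis (2 * pi * (rvec l \<bullet> x))"

end

theory Submission
  imports Defs
begin

text \<open>The measure is the law of the random series \<open>X\<close> of \<open>cum_inv R k (\<omega> k)\<close>, where the digits \<open>\<omega> k\<close>
  are independent and uniform on \<open>B k\<close>. All frame inequalities are proved in the space L2 of the digit
  space, for the functions \<open>expo \<xi> \<circ> X\<close>, and then pulled back along \<open>X\<close>; this makes the geometry of
  the cells, and hence the no-overlap condition, irrelevant. For a function \<open>w\<close> of the first \<open>n\<close>
  digits, independence splits the inner product with \<open>expo \<xi> \<circ> X\<close> into a finite exponential sum and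
  the Fourier transform of the tail at \<open>\<xi>\<close>. For frequencies in \<open>Lambda_n\<close> the latter has modulus between
  \<open>sqrt \<delta>\<close> and 1, and the former is controlled by the product of the first \<open>n\<close> frame triples. As such
  functions are dense, the frame bounds pass to the limit.

  If \<open>#B j = #L j\<close>, the product systems are square, so the lower frame bound is also a lower bound
  for the adjoint; applied to the conditional expectation of a trigonometric sum given the first \<open>n\<close>
  digits it yields the lower Riesz bound. If \<open>#B j < #L j\<close>, some nonzero frequency of the finite
  frame \<open>L j\<close> is redundant; deleting it leaves a frame tower, and removes infinitely many frequencies
  from \<open>Lambda\<close>.\<close>

section \<open>Finite systems and the product of frame triples\<close>

text \<open>The exponential matrix of n levels is not a tensor product of the single triples, since
  old frequencies also meet new digits. The induction survives because new frequencies do not meet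
  old digits, by integrality, and because the remaining cross term has modulus 1, like the twiddle
  factors of the fast Fourier transform. Approximants on the digit space need not factor through the
  point \<open>X\<close>: the inequalities hold on all of L2 of the digit space, and pulled-back
  functions are only a special case. Two obstacles shape the limit. The number of digits and the
  level of the frequencies must agree, because \<delta> controls the tail after n only at
  frequencies of \<open>Lambda_n\<close>. And this level grows with the accuracy of the
  approximation, so in the lower bound the error has to be controlled uniformly in the level. Hence
  the upper bound is settled first, on finite frequency sets, and the lower bound rests on it.
  Constants such as 4 * \<kappa> are not sharp: they come from using |a + b|^2 \<le> 2 |a|^2 + 2
  |b|^2 twice.\<close>

lemma underdetermined_system_solution:
  fixes v :: "'a \<Rightarrow> 'b \<Rightarrow> 'c::field"
  assumes "finite J" "finite I" "card J < card I"
  shows "\<exists>c. (\<exists>i\<in>I. c i \<noteq> 0) \<and> (\<forall>j\<in>J. (\<Sum>i\<in>I. c i * v i j) = 0)"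
  using assms
proof (induction J arbitrary: I v rule: finite_induct)
  case empty
  then have "I \<noteq> {}" by auto
  then show ?case by (intro exI[of _ "\<lambda>_. 1"]) auto
next
  case (insert j0 J)
  show ?case
  proof (cases "\<forall>i\<in>I. v i j0 = 0")
    case True
    from insert.IH[of I v] insert.prems insert.hyps obtain c where
      "\<exists>i\<in>I. c i \<noteq> 0" "\<forall>j\<in>J. (\<Sum>i\<in>I. c i * v i j) = 0" by auto
    then show ?thesis using True by (intro exI[of _ c]) auto
  next
    case False
    then obtain i0 where i0: "i0 \<in> I" "v i0 j0 \<noteq> 0" by auto
    \<comment> \<open>Gaussian elimination with pivot \<open>v i0 j0\<close>: the other rows are
      cleared at \<open>j0\<close>, and the coefficient of \<open>i0\<close> is then solved from the
      equation at \<open>j0\<close>.\<close>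
    define I' where "I' = I - {i0}"
    have I: "I = insert i0 I'" "i0 \<notin> I'" "finite I'" using i0 insert.prems by (auto simp: I'_def)
    have "card J < card I'" using insert.prems insert.hyps I by (simp add: card_insert_if)
    from insert.IH[OF I(3) this, of "\<lambda>i j. v i j - v i j0 / v i0 j0 * v i0 j"]
    obtain c where c: "\<exists>i\<in>I'. c i \<noteq> 0"
      "\<forall>j\<in>J. (\<Sum>i\<in>I'. c i * (v i j - v i j0 / v i0 j0 * v i0 j)) = 0" by auto
    define c' where "c' = c(i0 := - (\<Sum>i\<in>I'. c i * v i j0) / v i0 j0)"
    have eq: "(\<Sum>i\<in>I. c' i * v i j) = (\<Sum>i\<in>I'. c i * (v i j - v i j0 / v i0 j0 * v i0 j))" for j
    proof -
      have "(\<Sum>i\<in>I. c' i * v i j) = c' i0 * v i0 j + (\<Sum>i\<in>I'. c' i * v i j)"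
        using I by simp
      also have "(\<Sum>i\<in>I'. c' i * v i j) = (\<Sum>i\<in>I'. c i * v i j)"
        using I by (intro sum.cong) (auto simp: c'_def)
      also have "c' i0 * v i0 j = - (\<Sum>i\<in>I'. c i * (v i j0 / v i0 j0 * v i0 j))"
        by (simp add: c'_def sum_divide_distrib sum_distrib_right sum_negf[symmetric] mult.assoc)
      finally show ?thesis by (simp add: sum_subtractf algebra_simps)
    qed
    have "(\<Sum>i\<in>I. c' i * v i j0) = 0" unfolding eq using i0 by simp
    moreover have "\<forall>j\<in>J. (\<Sum>i\<in>I. c' i * v i j) = 0" unfolding eq using c by simp
    moreover have "\<exists>i\<in>I. c' i \<noteq> 0" using c(1) I by (auto simp: c'_def)
    ultimately show ?thesis by (intro exI[of _ c']) auto
  qed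
qed

text \<open>The lower bound makes the system injective, hence surjective when the sizes agree. So y
  is the image of some x with C * |x|^2 \<le> |y|^2, and |y|^2 is the inner product of x with the
  adjoint image of y.\<close>

lemma square_system_adjoint_bound:
  fixes E :: "'a \<Rightarrow> 'b \<Rightarrow> complex" and y :: "'b \<Rightarrow> complex"
  assumes fin: "finite I" "finite J" and card: "card I = card J" and C: "C > 0"
    and lower: "\<And>x. C * (\<Sum>i\<in>I. (cmod (x i))\<^sup>2) \<le> (\<Sum>j\<in>J. (cmod (\<Sum>i\<in>I. x i * E i j))\<^sup>2)"
  shows "C * (\<Sum>j\<in>J. (cmod (y j))\<^sup>2) \<le> (\<Sum>i\<in>I. (cmod (\<Sum>j\<in>J. y j * cnj (E i j)))\<^sup>2)"
proof -
  obtain x where x: "\<forall>j\<in>J. y j = (\<Sum>i\<in>I. x i * E i j)"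
  proof -
    \<comment> \<open>Adjoining y as an extra row \<open>None\<close> gives one row too many, hence
      a linear relation. Injectivity forces y to occur in it with nonzero coefficient.\<close>
    define v where "v = (\<lambda>i j. case i of None \<Rightarrow> y j | Some i \<Rightarrow> E i j)"
    have split: "(\<Sum>i\<in>insert None (Some ` I). f i) = f None + (\<Sum>i\<in>I. f (Some i))" for f :: "'a option \<Rightarrow> complex"
      using fin by (simp add: sum.reindex)
    have "card J < card (insert None (Some ` I))" using fin card by (simp add: card_image)
    from underdetermined_system_solution[OF fin(2) _ this, of v] fin obtain c where
      c: "\<exists>i\<in>insert None (Some ` I). c i \<noteq> 0"
      "\<forall>j\<in>J. (\<Sum>i\<in>insert None (Some ` I). c i * v i j) = 0" by auto
    have c2: "\<forall>j\<in>J. c None * y j + (\<Sum>i\<in>I. c (Some i) * E i j) = 0"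
      using c(2) unfolding split by (simp add: v_def)
    have "c None \<noteq> 0"
    proof
      assume "c None = 0"
      then have "(\<Sum>j\<in>J. (cmod (\<Sum>i\<in>I. c (Some i) * E i j))\<^sup>2) = 0" using c2 by simp
      with lower[of "\<lambda>i. c (Some i)"] C have "(\<Sum>i\<in>I. (cmod (c (Some i)))\<^sup>2) \<le> 0"
        by (simp add: mult_le_0_iff)
      then have "\<forall>i\<in>I. c (Some i) = 0"
        using fin sum_nonneg_eq_0_iff[of I "\<lambda>i. (cmod (c (Some i)))\<^sup>2"]
          sum_nonneg[of I "\<lambda>i. (cmod (c (Some i)))\<^sup>2"] by auto
      with c(1) \<open>c None = 0\<close> show False by auto
    qed
    then have "\<forall>j\<in>J. y j = (\<Sum>i\<in>I. (- c (Some i) / c None) * E i j)"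
      using c2 by (auto simp: sum_negf sum_divide_distrib[symmetric] field_simps eq_neg_iff_add_eq_0)
    then show ?thesis by (rule that)
  qed
  define X Y Z where "X = (\<Sum>i\<in>I. (cmod (x i))\<^sup>2)" and "Y = (\<Sum>j\<in>J. (cmod (y j))\<^sup>2)"
    and "Z = (\<Sum>i\<in>I. (cmod (\<Sum>j\<in>J. y j * cnj (E i j)))\<^sup>2)"
  let ?z = "\<lambda>i. \<Sum>j\<in>J. y j * cnj (E i j)"
  have "C * X \<le> (\<Sum>j\<in>J. (cmod (\<Sum>i\<in>I. x i * E i j))\<^sup>2)" unfolding X_def by (rule lower)
  also have "\<dots> = Y" unfolding Y_def using x by (intro sum.cong) auto
  finally have CX: "C * X \<le> Y" .
  have "complex_of_real Y = (\<Sum>j\<in>J. y j * cnj (y j))"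
    by (simp add: Y_def complex_norm_square del: of_real_power flip: of_real_power)
  also have "\<dots> = (\<Sum>j\<in>J. y j * cnj (\<Sum>i\<in>I. x i * E i j))" using x by (intro sum.cong) auto
  also have "\<dots> = (\<Sum>j\<in>J. \<Sum>i\<in>I. cnj (x i) * (y j * cnj (E i j)))"
    by (simp add: sum_distrib_left mult_ac)
  also have "\<dots> = (\<Sum>i\<in>I. cnj (x i) * ?z i)"
    by (subst sum.swap) (simp add: sum_distrib_left)
  finally have eq: "complex_of_real Y = (\<Sum>i\<in>I. cnj (x i) * ?z i)" .
  have "Y \<le> cmod (complex_of_real Y)" by simp
  also have "\<dots> \<le> (\<Sum>i\<in>I. cmod (x i) * cmod (?z i))"
    unfolding eq by (rule order_trans[OF norm_sum]) (simp add: norm_mult)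
  \<comment> \<open>The weight C is chosen so that \<open>C * X\<close> \<le> \<open>Y\<close>
    absorbs half of the left-hand side.\<close>
  also have "\<dots> \<le> (\<Sum>i\<in>I. (C * (cmod (x i))\<^sup>2 + (cmod (?z i))\<^sup>2 / C) / 2)"
  proof (intro sum_mono)
    fix i
    have "0 \<le> (C * cmod (x i) - cmod (?z i))\<^sup>2 / C" using C by simp
    then show "cmod (x i) * cmod (?z i) \<le> (C * (cmod (x i))\<^sup>2 + (cmod (?z i))\<^sup>2 / C) / 2"
      using C by (simp add: power2_diff power_mult_distrib field_simps power2_eq_square)
  qed
  also have "\<dots> = (C * X + Z / C) / 2"
    by (simp add: X_def Z_def sum.distrib sum_distrib_left sum_divide_distrib[symmetric])
  finally have "Y \<le> Z / C" using CX by simp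
  then show ?thesis using C by (simp add: Y_def Z_def field_simps)
qed

text \<open>With more vectors than dimensions there is a linear relation, and any vector occurring
  in it is a combination of the others; by Cauchy-Schwarz its share of the sum is at most S times
  theirs, which costs the factor 1 + S. The relation cannot be carried by \<open>j1\<close> alone,
  whose vector is nonzero, so \<open>j1\<close> can be protected from deletion. This keeps the
  frequency 0 later.\<close>

lemma lower_bound_drop_redundant:
  fixes E :: "'a \<Rightarrow> 'b \<Rightarrow> complex"
  assumes fin: "finite I" "finite J" and card: "card I < card J" and C: "C > 0"
    and j1: "i1 \<in> I" "E i1 j1 \<noteq> 0" "j1 \<in> J"
    and lower: "\<And>x. C * (\<Sum>i\<in>I. (cmod (x i))\<^sup>2) \<le> (\<Sum>j\<in>J. (cmod (\<Sum>i\<in>I. x i * E i j))\<^sup>2)"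
  shows "\<exists>j0\<in>J - {j1}. \<exists>C'>0. \<forall>x. C' * (\<Sum>i\<in>I. (cmod (x i))\<^sup>2)
            \<le> (\<Sum>j\<in>J - {j0}. (cmod (\<Sum>i\<in>I. x i * E i j))\<^sup>2)"
proof -
  from underdetermined_system_solution[OF fin card, of "\<lambda>j i. E i j"] obtain c where
    c: "\<exists>j\<in>J. c j \<noteq> 0" "\<forall>i\<in>I. (\<Sum>j\<in>J. c j * E i j) = 0" by auto
  obtain j0 where j0: "j0 \<in> J - {j1}" "c j0 \<noteq> 0"
  proof (rule ccontr)
    assume "\<not> thesis"
    with that have 0: "\<forall>j\<in>J - {j1}. c j = 0" by auto
    with c(1) j1 have "c j1 \<noteq> 0" by auto
    have "0 = (\<Sum>j\<in>J. c j * E i1 j)" using c j1 by simp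
    also have "\<dots> = (\<Sum>j\<in>{j1}. c j * E i1 j)" using 0 fin j1 by (intro sum.mono_neutral_right) auto
    finally show False using \<open>c j1 \<noteq> 0\<close> j1 by simp
  qed
  define S where "S = (\<Sum>j\<in>J - {j0}. (cmod (c j / c j0))\<^sup>2)"
  have S: "S \<ge> 0" by (simp add: S_def sum_nonneg)
  have "C / (1 + S) * (\<Sum>i\<in>I. (cmod (x i))\<^sup>2) \<le> (\<Sum>j\<in>J - {j0}. (cmod (\<Sum>i\<in>I. x i * E i j))\<^sup>2)" for x
  proof -
    define F where "F = (\<lambda>j. \<Sum>i\<in>I. x i * E i j)"
    have "(\<Sum>j\<in>J. c j * F j) = (\<Sum>i\<in>I. x i * (\<Sum>j\<in>J. c j * E i j))"
      unfolding F_def sum_distrib_left by (subst sum.swap) (simp add: mult_ac)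
    also have "\<dots> = 0" using c by simp
    finally have "c j0 * F j0 + (\<Sum>j\<in>J-{j0}. c j * F j) = 0"
      using fin j0 by (simp add: sum.remove[of J j0])
    then have F0: "F j0 = - (\<Sum>j\<in>J-{j0}. c j / c j0 * F j)"
      using j0 by (simp add: sum_divide_distrib[symmetric] field_simps eq_neg_iff_add_eq_0)
    have "cmod (F j0) \<le> (\<Sum>j\<in>J-{j0}. cmod (c j / c j0) * cmod (F j))"
      unfolding F0 norm_minus_cancel by (rule order_trans[OF norm_sum]) (simp add: norm_mult norm_divide)
    then have "(cmod (F j0))\<^sup>2 \<le> (\<Sum>j\<in>J-{j0}. cmod (c j / c j0) * cmod (F j))\<^sup>2"
      by (intro power_mono) auto
    also have "\<dots> \<le> S * (\<Sum>j\<in>J-{j0}. (cmod (F j))\<^sup>2)"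
      unfolding S_def by (rule Cauchy_Schwarz_ineq_sum)
    finally have "(\<Sum>j\<in>J. (cmod (F j))\<^sup>2) \<le> (1 + S) * (\<Sum>j\<in>J-{j0}. (cmod (F j))\<^sup>2)"
      using fin j0 by (simp add: sum.remove[of J j0] algebra_simps)
    with lower[of x] have "C * (\<Sum>i\<in>I. (cmod (x i))\<^sup>2) \<le> (1 + S) * (\<Sum>j\<in>J-{j0}. (cmod (F j))\<^sup>2)"
      unfolding F_def by linarith
    then show ?thesis using S by (simp add: F_def field_simps)
  qed
  moreover have "C / (1 + S) > 0" using C S by simp
  ultimately show ?thesis using j0 by blast
qed

section \<open>Integer matrices and exponentials along the tower\<close>

lemma rmat_mult: "rmat (M ** N) = rmat M ** rmat N"
  by (simp add: rmat_def vec_eq_iff matrix_matrix_mult_def)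

lemma rmat_mult_rvec: "rmat M *v rvec v = rvec (M *v v)"
  by (simp add: rmat_def rvec_def vec_eq_iff matrix_vector_mult_def)

lemma rmat_mat_1: "rmat (mat 1) = mat 1"
  by (simp add: rmat_def vec_eq_iff mat_def)

lemma rvec_add: "rvec (u + v) = rvec u + rvec v"
  by (simp add: rvec_def vec_eq_iff)

lemma rvec_inner_Ints: "rvec u \<bullet> rvec v \<in> \<int>"
  by (auto simp: rvec_def inner_vec_def intro!: Ints_sum)

lemma rvec_transpose_inner: "rvec (transpose M *v m) \<bullet> u = rvec m \<bullet> (rmat M *v u)"
proof -
  have "rvec (transpose M *v m) = rvec m v* rmat M"
    by (simp add: rvec_def rmat_def vec_eq_iff matrix_vector_mult_def vector_matrix_mult_def transpose_def mult.commute)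
  then show ?thesis by (simp add: dot_lmul_matrix)
qed

text \<open>A real kernel vector, read as a complex one, would be an eigenvector for the eigenvalue
  0.\<close>

lemma expanding_invertible:
  assumes "expanding M"
  shows "invertible (rmat M)"
proof -
  have "v = 0" if "rmat M *v v = 0" for v :: "real ^ 'a"
  proof (rule ccontr)
    assume "v \<noteq> 0"
    define w :: "complex ^ 'a" where "w = (\<chi> i. of_real (v $ i))"
    have "w \<noteq> 0" using \<open>v \<noteq> 0\<close> by (auto simp: w_def vec_eq_iff)
    moreover have "map_matrix of_int M *v w = 0 *s w"
    proof -
      have "(map_matrix of_int M *v w) $ i = of_real ((rmat M *v v) $ i)" for i
        by (simp add: w_def rmat_def matrix_vector_mult_def)
      then show ?thesis by (simp add: vec_eq_iff that)
    qed
    ultimately have "cmod 0 > 1" using assms unfolding expanding_def by blast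
    then show False by simp
  qed
  then show ?thesis
    by (simp add: invertible_left_inverse matrix_left_invertible_ker)
qed

lemma expo_add_freq: "expo (l + m) x = expo l x * expo m x"
  by (simp add: expo_def rvec_add inner_add_left algebra_simps cis_mult)

lemma expo_add: "expo l (x + y) = expo l x * expo l y"
  by (simp add: expo_def inner_add_right algebra_simps cis_mult)

lemma norm_expo [simp]: "cmod (expo l x) = 1"
  by (simp add: expo_def)

lemma expo_sum: "expo l (\<Sum>k\<in>A. f k) = (\<Prod>k\<in>A. expo l (f k))"
proof (induction A rule: infinite_finite_induct)
  case (insert x F)
  then show ?case by (simp add: expo_add)
qed (simp_all add: expo_def)

lemma sum_PiE_Suc:
  assumes "\<forall>k\<ge>1. finite (A k)"
  shows "(\<Sum>b\<in>(\<Pi>\<^sub>E k\<in>{1..Suc n}. A k). f b)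
    = (\<Sum>b\<in>(\<Pi>\<^sub>E k\<in>{1..n}. A k). \<Sum>c\<in>A (Suc n). f (b(Suc n := c)))"
proof -
  have "(\<Sum>b\<in>(\<Pi>\<^sub>E k\<in>{1..Suc n}. A k). f b)
     = (\<Sum>b\<in>(\<lambda>(c, b). b(Suc n := c)) ` (A (Suc n) \<times> (\<Pi>\<^sub>E k\<in>{1..n}. A k)). f b)"
    by (simp add: atLeastAtMostSuc_conv PiE_insert_eq)
  also have "\<dots> = (\<Sum>(c, b)\<in>A (Suc n) \<times> (\<Pi>\<^sub>E k\<in>{1..n}. A k). f (b(Suc n := c)))"
    using inj_combinator[of "Suc n" "{1..n}" A] by (subst sum.reindex) (auto simp: case_prod_unfold)
  also have "\<dots> = (\<Sum>c\<in>A (Suc n). \<Sum>b\<in>(\<Pi>\<^sub>E k\<in>{1..n}. A k). f (b(Suc n := c)))"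
    by (rule sum.cartesian_product[symmetric])
  finally show ?thesis by (simp add: sum.swap[of _ "A (Suc n)"])
qed

definition digit_sum :: "(nat \<Rightarrow> int ^ 'n ^ 'n) \<Rightarrow> nat \<Rightarrow> (nat \<Rightarrow> int ^ 'n) \<Rightarrow> real ^ 'n"
  where "digit_sum R n b = (\<Sum>k=1..n. cum_inv R k (b k))"

lemma digit_sum_Suc: "digit_sum R (Suc n) (b(Suc n := c)) = digit_sum R n b + cum_inv R (Suc n) c"
  by (simp add: digit_sum_def)

lemma freq_sum_Suc:
  "freq_sum R (Suc n) (l(Suc n := m)) = freq_sum R n l + transpose (cum_mat R n) *v m"
  by (simp add: freq_sum_def)

lemma invertible_cum_mat:
  assumes "\<forall>k\<ge>1. invertible (rmat (R k))"
  shows "invertible (rmat (cum_mat R n))"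
  using assms
  by (induction n) (auto simp: rmat_mat_1 rmat_mult invertible_mult invertible_det_nz[of "mat 1"])

lemma matrix_mul_inv_vec:
  fixes M :: "real ^ 'n ^ 'n"
  assumes "invertible M"
  shows "M *v (matrix_inv M *v v) = v" "matrix_inv M *v (M *v v) = v"
proof -
  have "M ** matrix_inv M = mat 1 \<and> matrix_inv M ** M = mat 1"
    using assms unfolding invertible_def matrix_inv_def by (rule someI_ex)
  then show "M *v (matrix_inv M *v v) = v" "matrix_inv M *v (M *v v) = v"
    by (simp_all add: matrix_vector_mul_assoc)
qed

text \<open>For k \<le> n the matrices cancel down to the product of \<open>R n\<close>, ...,
  \<open>R (Suc k)\<close>, which has integer entries.\<close>

lemma cum_mat_cum_inv_int:
  assumes "\<forall>k\<ge>1. invertible (rmat (R k))" "k \<le> n"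
  shows "\<exists>z. rmat (cum_mat R n) *v cum_inv R k b = rvec z"
  using \<open>k \<le> n\<close>
proof (induction n rule: dec_induct)
  case base
  then show ?case
    using matrix_mul_inv_vec(1)[OF invertible_cum_mat[OF assms(1)]] by (auto simp: cum_inv_def)
next
  case (step m)
  then obtain z where "rmat (cum_mat R m) *v cum_inv R k b = rvec z" by auto
  then have "rmat (cum_mat R (Suc m)) *v cum_inv R k b = rvec (R (Suc m) *v z)"
    by (simp add: rmat_mult rmat_mult_rvec flip: matrix_vector_mul_assoc)
  then show ?case by blast
qed

text \<open>One index beyond n the cancellation leaves exactly one inverse, the one that enters the
  single triple at \<open>Suc n\<close>.\<close>

lemma cum_mat_cum_inv_Suc:
  assumes "\<forall>k\<ge>1. invertible (rmat (R k))"
  shows "rmat (cum_mat R n) *v cum_inv R (Suc n) c = matrix_inv (rmat (R (Suc n))) *v rvec c"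
proof -
  have "rmat (R (Suc n)) *v (rmat (cum_mat R n) *v cum_inv R (Suc n) c) = rvec c"
    using matrix_mul_inv_vec(1)[OF invertible_cum_mat[OF assms(1), of "Suc n"]]
    by (simp add: cum_inv_def rmat_mult flip: matrix_vector_mul_assoc)
  moreover have "invertible (rmat (R (Suc n)))" using assms by simp
  ultimately show ?thesis using matrix_mul_inv_vec(2) by metis
qed

lemma cis_2pi_Ints: "x \<in> \<int> \<Longrightarrow> cis (2 * pi * x) = 1"
  by (metis cis_multiple_2pi)

text \<open>Moving the transpose to the other side of the inner product leaves two integer vectors:
  frequencies added after level n do not see the first n digits.\<close>

lemma expo_transpose_digit_sum:
  assumes "\<forall>k\<ge>1. invertible (rmat (R k))"
  shows "expo (transpose (cum_mat R n) *v m) (digit_sum R n b) = 1"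
proof -
  have "expo (transpose (cum_mat R n) *v m) (cum_inv R k (b k)) = 1" if k: "k \<in> {1..n}" for k
  proof -
    obtain z where "rmat (cum_mat R n) *v cum_inv R k (b k) = rvec z"
      using cum_mat_cum_inv_int[OF assms, of k n "b k"] k by auto
    then show ?thesis
      unfolding expo_def rvec_transpose_inner by (simp add: cis_2pi_Ints rvec_inner_Ints)
  qed
  then show ?thesis unfolding digit_sum_def expo_sum by (intro prod.neutral) blast
qed

text \<open>The entry of \<open>triple_vec\<close> without its normalisation, so that the digit
  counts can be collected in one factor.\<close>

definition phase :: "int ^ 'n ^ 'n \<Rightarrow> int ^ 'n \<Rightarrow> int ^ 'n \<Rightarrow> complex"
  where "phase M m c = cis (2 * pi * ((matrix_inv (rmat M) *v rvec c) \<bullet> rvec m))"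

text \<open>Of the three factors produced by the new level, new frequency against old digits is 1,
  new against new is the phase of the single triple, and old frequency against new digit stays as a
  unimodular twiddle factor.\<close>

lemma expo_Suc:
  assumes "\<forall>k\<ge>1. invertible (rmat (R k))"
  shows "expo (freq_sum R (Suc n) (l(Suc n := m))) (digit_sum R (Suc n) (b(Suc n := c)))
    = expo (freq_sum R n l) (digit_sum R n b)
      * (expo (freq_sum R n l) (cum_inv R (Suc n) c) * phase (R (Suc n)) m c)"
proof -
  have "expo (transpose (cum_mat R n) *v m) (cum_inv R (Suc n) c) = phase (R (Suc n)) m c"
    unfolding expo_def rvec_transpose_inner cum_mat_cum_inv_Suc[OF assms] phase_def
    by (simp add: inner_commute)
  then show ?thesis
    unfolding freq_sum_Suc digit_sum_Suc expo_add_freq expo_add expo_transpose_digit_sum[OF assms]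
    by (simp add: mult_ac)
qed

lemma triple_vec_phase: "triple_vec M B m c = of_real (1 / sqrt (card B)) * phase M m c"
  by (simp add: triple_vec_def phase_def)

text \<open>Frame bounds multiply: the induction hypothesis is applied for each fixed last digit,
  then the last triple for each fixed old frequency tuple. The factor of digit counts appears
  because the exponentials are not normalised.\<close>

lemma tower_product_bounds:
  fixes R :: "nat \<Rightarrow> int ^ 'n::finite ^ 'n" and C D :: "nat \<Rightarrow> real"
  assumes inv: "\<forall>k\<ge>1. invertible (rmat (R k))"
    and finB: "\<forall>k\<ge>1. finite (B k)" and neB: "\<forall>k\<ge>1. B k \<noteq> {}"
    and finL: "\<forall>k\<ge>1. finite (L k)"
    and pos: "\<forall>k\<ge>1. 0 \<le> C k \<and> 0 \<le> D k"
    and lower: "\<And>k x. k \<ge> 1 \<Longrightarrow> C k * (\<Sum>b\<in>B k. (cmod (x b))\<^sup>2)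
          \<le> (\<Sum>l\<in>L k. (cmod (\<Sum>b\<in>B k. x b * cnj (triple_vec (R k) (B k) l b)))\<^sup>2)"
    and upper: "\<And>k x. k \<ge> 1 \<Longrightarrow>
        (\<Sum>l\<in>L k. (cmod (\<Sum>b\<in>B k. x b * cnj (triple_vec (R k) (B k) l b)))\<^sup>2)
          \<le> D k * (\<Sum>b\<in>B k. (cmod (x b))\<^sup>2)"
  shows "(\<Prod>k=1..n. C k) * (\<Prod>k=1..n. real (card (B k))) * (\<Sum>b\<in>(\<Pi>\<^sub>E k\<in>{1..n}. B k). (cmod (w b))\<^sup>2)
      \<le> (\<Sum>l\<in>(\<Pi>\<^sub>E k\<in>{1..n}. L k).
          (cmod (\<Sum>b\<in>(\<Pi>\<^sub>E k\<in>{1..n}. B k). w b * cnj (expo (freq_sum R n l) (digit_sum R n b))))\<^sup>2)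
    \<and> (\<Sum>l\<in>(\<Pi>\<^sub>E k\<in>{1..n}. L k).
          (cmod (\<Sum>b\<in>(\<Pi>\<^sub>E k\<in>{1..n}. B k). w b * cnj (expo (freq_sum R n l) (digit_sum R n b))))\<^sup>2)
      \<le> (\<Prod>k=1..n. D k) * (\<Prod>k=1..n. real (card (B k))) * (\<Sum>b\<in>(\<Pi>\<^sub>E k\<in>{1..n}. B k). (cmod (w b))\<^sup>2)"
proof (induction n arbitrary: w)
  case 0
  then show ?case by (simp add: freq_sum_def digit_sum_def norm_mult)
next
  case (Suc n)
  let ?PB = "\<Pi>\<^sub>E k\<in>{1..n}. B k" and ?PL = "\<Pi>\<^sub>E k\<in>{1..n}. L k"
  let ?K = "Suc n"
  define N where "N = (\<Prod>k=1..n. real (card (B k)))"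
  define P Q where "P = (\<Prod>k=1..n. C k)" and "Q = (\<Prod>k=1..n. D k)"
  define \<beta> where "\<beta> = real (card (B ?K))"
  have \<beta>: "\<beta> > 0" using finB neB by (simp add: \<beta>_def card_gt_0_iff)
  \<comment> \<open>\<open>G\<close> sums over the old digits with the last digit c frozen. The
    twiddle factor depends only on l and c, so \<open>y\<close> can absorb it without changing any
    modulus.\<close>
  define G where "G = (\<lambda>l c. \<Sum>b\<in>?PB. w (b(?K := c)) * cnj (expo (freq_sum R n l) (digit_sum R n b)))"
  define y where "y = (\<lambda>l c. cnj (expo (freq_sum R n l) (cum_inv R ?K c)) * G l c)"
  have F: "(\<Sum>b\<in>(\<Pi>\<^sub>E k\<in>{1..?K}. B k). w b * cnj (expo (freq_sum R ?K (l(?K := m))) (digit_sum R ?K b)))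
      = (\<Sum>c\<in>B ?K. y l c * cnj (phase (R ?K) m c))" for l m
    unfolding sum_PiE_Suc[OF finB] expo_Suc[OF inv] y_def G_def
    by (subst sum.swap) (simp add: sum_distrib_left sum_distrib_right mult_ac)
  have tri: "(cmod (\<Sum>c\<in>B ?K. x c * cnj (triple_vec (R ?K) (B ?K) m c)))\<^sup>2
      = (cmod (\<Sum>c\<in>B ?K. x c * cnj (phase (R ?K) m c)))\<^sup>2 / \<beta>" for x m
  proof -
    have "(\<Sum>c\<in>B ?K. x c * cnj (triple_vec (R ?K) (B ?K) m c))
        = of_real (1 / sqrt \<beta>) * (\<Sum>c\<in>B ?K. x c * cnj (phase (R ?K) m c))"
      by (simp add: triple_vec_phase sum_distrib_left \<beta>_def mult_ac)
    then show ?thesis using \<beta> by (simp add: norm_mult power_mult_distrib norm_divide power_divide)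
  qed
  have lo: "C ?K * \<beta> * (\<Sum>c\<in>B ?K. (cmod (x c))\<^sup>2)
      \<le> (\<Sum>m\<in>L ?K. (cmod (\<Sum>c\<in>B ?K. x c * cnj (phase (R ?K) m c)))\<^sup>2)" for x
    using lower[of ?K x] \<beta> unfolding tri by (simp add: sum_divide_distrib[symmetric] field_simps)
  have up: "(\<Sum>m\<in>L ?K. (cmod (\<Sum>c\<in>B ?K. x c * cnj (phase (R ?K) m c)))\<^sup>2)
      \<le> D ?K * \<beta> * (\<Sum>c\<in>B ?K. (cmod (x c))\<^sup>2)" for x
    using upper[of ?K x] \<beta> unfolding tri by (simp add: sum_divide_distrib[symmetric] field_simps)
  have ny: "cmod (y l c) = cmod (G l c)" for l c by (simp add: y_def norm_mult)
  have W: "(\<Sum>b\<in>(\<Pi>\<^sub>E k\<in>{1..?K}. B k). (cmod (w b))\<^sup>2) = (\<Sum>c\<in>B ?K. \<Sum>b\<in>?PB. (cmod (w (b(?K := c))))\<^sup>2)"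
    unfolding sum_PiE_Suc[OF finB] by (rule sum.swap)
  have S: "(\<Sum>l\<in>(\<Pi>\<^sub>E k\<in>{1..?K}. L k).
          (cmod (\<Sum>b\<in>(\<Pi>\<^sub>E k\<in>{1..?K}. B k). w b * cnj (expo (freq_sum R ?K l) (digit_sum R ?K b))))\<^sup>2)
     = (\<Sum>l\<in>?PL. \<Sum>m\<in>L ?K. (cmod (\<Sum>c\<in>B ?K. y l c * cnj (phase (R ?K) m c)))\<^sup>2)"
    unfolding sum_PiE_Suc[OF finL] F ..
  have T: "(\<Sum>l\<in>?PL. \<Sum>c\<in>B ?K. (cmod (y l c))\<^sup>2) = (\<Sum>c\<in>B ?K. \<Sum>l\<in>?PL. (cmod (G l c))\<^sup>2)"
    unfolding ny by (rule sum.swap)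
  have C0: "0 \<le> C ?K * \<beta>" "0 \<le> D ?K * \<beta>" using pos \<beta> by auto
  have ih: "P * N * (\<Sum>b\<in>?PB. (cmod (w (b(?K := c))))\<^sup>2) \<le> (\<Sum>l\<in>?PL. (cmod (G l c))\<^sup>2)"
     "(\<Sum>l\<in>?PL. (cmod (G l c))\<^sup>2) \<le> Q * N * (\<Sum>b\<in>?PB. (cmod (w (b(?K := c))))\<^sup>2)" for c
    using Suc.IH[of "\<lambda>b. w (b(?K := c))"] unfolding P_def Q_def N_def G_def by auto
  have "C ?K * \<beta> * (P * N * (\<Sum>c\<in>B ?K. \<Sum>b\<in>?PB. (cmod (w (b(?K := c))))\<^sup>2))
     \<le> C ?K * \<beta> * (\<Sum>c\<in>B ?K. \<Sum>l\<in>?PL. (cmod (G l c))\<^sup>2)"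
    unfolding sum_distrib_left[of "P * N" _ "B ?K"] by (intro mult_left_mono sum_mono ih C0)
  also have "\<dots> \<le> (\<Sum>l\<in>?PL. \<Sum>m\<in>L ?K. (cmod (\<Sum>c\<in>B ?K. y l c * cnj (phase (R ?K) m c)))\<^sup>2)"
    unfolding T[symmetric] sum_distrib_left[of "C ?K * \<beta>" _ "?PL"] by (intro sum_mono lo)
  finally have low: "C ?K * \<beta> * (P * N * (\<Sum>c\<in>B ?K. \<Sum>b\<in>?PB. (cmod (w (b(?K := c))))\<^sup>2)) \<le> \<dots>" .
  have "(\<Sum>l\<in>?PL. \<Sum>m\<in>L ?K. (cmod (\<Sum>c\<in>B ?K. y l c * cnj (phase (R ?K) m c)))\<^sup>2)
     \<le> D ?K * \<beta> * (\<Sum>c\<in>B ?K. \<Sum>l\<in>?PL. (cmod (G l c))\<^sup>2)"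
    unfolding T[symmetric] sum_distrib_left[of "D ?K * \<beta>" _ "?PL"] by (intro sum_mono up)
  also have "\<dots> \<le> D ?K * \<beta> * (Q * N * (\<Sum>c\<in>B ?K. \<Sum>b\<in>?PB. (cmod (w (b(?K := c))))\<^sup>2))"
    unfolding sum_distrib_left[of "Q * N" _ "B ?K"] by (intro mult_left_mono sum_mono ih C0)
  finally have upp: "(\<Sum>l\<in>?PL. \<Sum>m\<in>L ?K. (cmod (\<Sum>c\<in>B ?K. y l c * cnj (phase (R ?K) m c)))\<^sup>2) \<le> \<dots>" .
  have prods: "(\<Prod>k=1..?K. C k) = P * C ?K" "(\<Prod>k=1..?K. D k) = Q * D ?K"
    "(\<Prod>k=1..?K. real (card (B k))) = N * \<beta>"
    by (simp_all add: P_def Q_def N_def \<beta>_def)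
  show ?case unfolding S W prods using low upp by (simp only: mult_ac)
qed

section \<open>Density in L2\<close>

lemma L2_measurable [measurable_dest]: "f \<in> L2 M \<Longrightarrow> f \<in> borel_measurable M"
  by (simp add: L2_def)

lemma borel_measurable_cnj [measurable (raw)]:
  "f \<in> borel_measurable M \<Longrightarrow> (\<lambda>x. cnj (f x)) \<in> borel_measurable M"
  by (rule borel_measurable_continuous_on) (auto intro!: continuous_intros)

lemma L2_integrable: "f \<in> L2 M \<Longrightarrow> integrable M (\<lambda>x. (cmod (f x))\<^sup>2)"
  by (simp add: L2_def)

lemma L2_integrable_prod:
  assumes [measurable]: "f \<in> L2 M" "g \<in> L2 M"
  shows "integrable M (\<lambda>x. f x * cnj (g x))"
proof (rule Bochner_Integration.integrable_bound)
  show "integrable M (\<lambda>x. (cmod (f x))\<^sup>2 + (cmod (g x))\<^sup>2)"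
    using assms by (simp add: L2_integrable)
  show "(\<lambda>x. f x * cnj (g x)) \<in> borel_measurable M" by measurable
  show "AE x in M. norm (f x * cnj (g x)) \<le> norm ((cmod (f x))\<^sup>2 + (cmod (g x))\<^sup>2)"
  proof (intro AE_I2)
    fix x
    have "0 \<le> (cmod (f x) - cmod (g x))\<^sup>2 + (cmod (f x))\<^sup>2 + (cmod (g x))\<^sup>2" by simp
    then show "norm (f x * cnj (g x)) \<le> norm ((cmod (f x))\<^sup>2 + (cmod (g x))\<^sup>2)"
      by (simp add: norm_mult power2_diff)
  qed
qed

lemma cmod_diff_sq: "(cmod (a - b))\<^sup>2 = (cmod a)\<^sup>2 - 2 * Re (a * cnj b) + (cmod b)\<^sup>2"
  unfolding cmod_power2 by (simp add: power2_eq_square algebra_simps)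

lemma cmod_add_sq_le: "(cmod (a + b))\<^sup>2 \<le> 2 * (cmod a)\<^sup>2 + 2 * (cmod b)\<^sup>2"
proof -
  have "(cmod (a + b))\<^sup>2 + (cmod (a - b))\<^sup>2 = 2 * (cmod a)\<^sup>2 + 2 * (cmod b)\<^sup>2"
    unfolding cmod_power2 by (simp add: power2_eq_square algebra_simps)
  then show ?thesis by (smt (verit) zero_le_power2)
qed

lemma L2_cmult: "f \<in> L2 M \<Longrightarrow> (\<lambda>x. c * f x) \<in> L2 M"
  by (auto simp: L2_def norm_mult power_mult_distrib)

lemma L2_add:
  assumes [measurable]: "f \<in> L2 M" "g \<in> L2 M"
  shows "(\<lambda>x. f x + g x) \<in> L2 M"
proof -
  have "integrable M (\<lambda>x. (cmod (f x + g x))\<^sup>2)"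
  proof (rule Bochner_Integration.integrable_bound)
    show "integrable M (\<lambda>x. 2 * (cmod (f x))\<^sup>2 + 2 * (cmod (g x))\<^sup>2)"
      using assms by (simp add: L2_integrable)
    show "(\<lambda>x. (cmod (f x + g x))\<^sup>2) \<in> borel_measurable M" by measurable
  qed (simp add: cmod_add_sq_le)
  then show ?thesis by (simp add: L2_def)
qed

lemma L2_diff:
  assumes [measurable]: "f \<in> L2 M" "g \<in> L2 M"
  shows "(\<lambda>x. f x - g x) \<in> L2 M"
  using L2_add[OF assms(1) L2_cmult[OF assms(2), of "-1"]] by simp

lemma L2_sum: "(\<And>i. i \<in> I \<Longrightarrow> f i \<in> L2 M) \<Longrightarrow> (\<lambda>x. \<Sum>i\<in>I. f i x) \<in> L2 M"
  by (induction I rule: infinite_finite_induct) (simp_all add: L2_add, simp_all add: L2_def)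

lemma (in finite_measure) L2_bounded:
  assumes "f \<in> borel_measurable M" "\<And>x. x \<in> space M \<Longrightarrow> cmod (f x) \<le> K"
  shows "f \<in> L2 M"
proof -
  have "integrable M (\<lambda>x. (cmod (f x))\<^sup>2)"
    using assms by (intro integrable_const_bound[of _ "K\<^sup>2"]) (auto intro!: power_mono)
  then show ?thesis using assms by (simp add: L2_def)
qed

lemma L2_norm_sq_nonneg: "0 \<le> L2_norm_sq M f"
  by (simp add: L2_norm_sq_def)

lemma L2_norm_sq_cmult: "L2_norm_sq M (\<lambda>x. c * f x) = (cmod c)\<^sup>2 * L2_norm_sq M f"
  by (simp add: L2_norm_sq_def norm_mult power_mult_distrib)

lemma L2_norm_sq_add_le:
  assumes [measurable]: "f \<in> L2 M" "g \<in> L2 M"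
  shows "L2_norm_sq M (\<lambda>x. f x + g x) \<le> 2 * L2_norm_sq M f + 2 * L2_norm_sq M g"
proof -
  have "L2_norm_sq M (\<lambda>x. f x + g x) \<le> (\<integral>x. 2 * (cmod (f x))\<^sup>2 + 2 * (cmod (g x))\<^sup>2 \<partial>M)"
    unfolding L2_norm_sq_def using L2_add[OF assms] assms
    by (intro integral_mono) (auto simp: L2_def cmod_add_sq_le)
  also have "\<dots> = 2 * L2_norm_sq M f + 2 * L2_norm_sq M g"
    using assms by (simp add: L2_def L2_norm_sq_def)
  finally show ?thesis .
qed

lemma L2_norm_sq_diff_commute: "L2_norm_sq M (\<lambda>x. f x - g x) = L2_norm_sq M (\<lambda>x. g x - f x)"
  by (simp add: L2_norm_sq_def norm_minus_commute)

lemma L2_norm_sq_diff: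
  assumes [measurable]: "f \<in> L2 M" "g \<in> L2 M"
  shows "L2_norm_sq M (\<lambda>x. f x - g x) = L2_norm_sq M f - 2 * Re (L2_inner M f g) + L2_norm_sq M g"
proof -
  have i: "integrable M (\<lambda>x. f x * cnj (g x))" by (rule L2_integrable_prod[OF assms])
  have "L2_norm_sq M (\<lambda>x. f x - g x)
      = (\<integral>x. (cmod (f x))\<^sup>2 - 2 * Re (f x * cnj (g x)) + (cmod (g x))\<^sup>2 \<partial>M)"
    unfolding L2_norm_sq_def cmod_diff_sq ..
  also have "\<dots> = (\<integral>x. (cmod (f x))\<^sup>2 \<partial>M) - 2 * (\<integral>x. Re (f x * cnj (g x)) \<partial>M) + (\<integral>x. (cmod (g x))\<^sup>2 \<partial>M)"
    using assms[THEN L2_integrable] integrable_Re[OF i] by (simp del: times_complex.sel)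
  also have "(\<integral>x. Re (f x * cnj (g x)) \<partial>M) = Re (L2_inner M f g)"
    unfolding L2_inner_def by (rule integral_Re[OF i])
  finally show ?thesis by (simp add: L2_norm_sq_def)
qed

lemma L2_inner_diff_left:
  assumes "f \<in> L2 M" "g \<in> L2 M" "h \<in> L2 M"
  shows "L2_inner M (\<lambda>x. f x - g x) h = L2_inner M f h - L2_inner M g h"
  using L2_integrable_prod[OF assms(1,3)] L2_integrable_prod[OF assms(2,3)]
  by (simp add: L2_inner_def algebra_simps)

lemma L2_inner_cmult_right: "L2_inner M f (\<lambda>x. c * g x) = cnj c * L2_inner M f g"
  by (simp add: L2_inner_def mult.left_commute flip: integral_mult_right_zero)

lemma L2_inner_sum_right:
  assumes "f \<in> L2 M" "\<And>i. i \<in> I \<Longrightarrow> g i \<in> L2 M"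
  shows "L2_inner M f (\<lambda>x. \<Sum>i\<in>I. g i x) = (\<Sum>i\<in>I. L2_inner M f (g i))"
  using L2_integrable_prod[OF assms(1) assms(2)]
  by (simp add: L2_inner_def sum_distrib_left)

lemma L2_inner_self: "L2_inner M f f = of_real (L2_norm_sq M f)"
proof -
  have "L2_inner M f f = (\<integral>x. complex_of_real ((cmod (f x))\<^sup>2) \<partial>M)"
    unfolding L2_inner_def by (subst complex_norm_square) (rule refl)
  also have "\<dots> = of_real (L2_norm_sq M f)"
    unfolding L2_norm_sq_def by (rule integral_complex_of_real)
  finally show ?thesis .
qed

text \<open>On a probability space e is a unit vector; with c the inner product of f and e, the
  squared norm of f - c e is nonnegative.\<close>

lemma (in prob_space) L2_inner_unimodular_le:
  assumes f: "f \<in> L2 M" and e: "e \<in> borel_measurable M" "\<And>x. cmod (e x) = 1"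
  shows "(cmod (L2_inner M f e))\<^sup>2 \<le> L2_norm_sq M f"
proof -
  define c where "c = L2_inner M f e"
  have e2: "e \<in> L2 M" using e by (intro L2_bounded[of _ 1]) auto
  have "L2_norm_sq M e = 1" using e by (simp add: L2_norm_sq_def prob_space)
  then have "0 \<le> L2_norm_sq M f - 2 * (cmod c)\<^sup>2 + (cmod c)\<^sup>2"
    using L2_norm_sq_diff[OF f L2_cmult[OF e2, of c]] L2_norm_sq_nonneg[of M "\<lambda>x. f x - c * e x"]
    by (simp add: L2_inner_cmult_right L2_norm_sq_cmult c_def[symmetric] cmod_power2 mult.commute
        flip: power2_eq_square)
  then show ?thesis by (simp add: c_def)
qed

text \<open>Distances are measured by squared norms, so the triangle inequality takes the form with
  factors 2 and 2; this is the origin of the quarters of \<epsilon> below.\<close>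

definition L2_closure :: "'a measure \<Rightarrow> ('a \<Rightarrow> complex) set \<Rightarrow> ('a \<Rightarrow> complex) set"
  where "L2_closure M V = {f \<in> L2 M. \<forall>\<epsilon>>0. \<exists>g\<in>V. L2_norm_sq M (\<lambda>x. f x - g x) < \<epsilon>}"

lemma L2_closureE:
  assumes "f \<in> L2_closure M V" "\<epsilon> > 0"
  obtains g where "g \<in> V" "L2_norm_sq M (\<lambda>x. f x - g x) < \<epsilon>"
  using assms unfolding L2_closure_def by blast

lemma L2_closure_superset: "V \<subseteq> L2 M \<Longrightarrow> V \<subseteq> L2_closure M V"
  by (force simp: L2_closure_def L2_norm_sq_def)

lemma L2_closure_idem:
  assumes V: "V \<subseteq> L2 M" and f: "f \<in> L2 M"
    and approx: "\<And>\<epsilon>. \<epsilon> > 0 \<Longrightarrow> \<exists>g\<in>L2_closure M V. L2_norm_sq M (\<lambda>x. f x - g x) < \<epsilon>"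
  shows "f \<in> L2_closure M V"
  unfolding L2_closure_def
proof (intro CollectI conjI f allI impI)
  fix \<epsilon> :: real assume "\<epsilon> > 0"
  then obtain g where g: "g \<in> L2_closure M V" "L2_norm_sq M (\<lambda>x. f x - g x) < \<epsilon> / 4"
    using approx[of "\<epsilon> / 4"] by auto
  then obtain h where h: "h \<in> V" "L2_norm_sq M (\<lambda>x. g x - h x) < \<epsilon> / 4"
    using \<open>\<epsilon> > 0\<close> by (auto elim: L2_closureE[of _ _ _ "\<epsilon> / 4"])
  have L: "g \<in> L2 M" "h \<in> L2 M" using g h V by (auto simp: L2_closure_def)
  have "L2_norm_sq M (\<lambda>x. f x - h x) = L2_norm_sq M (\<lambda>x. (f x - g x) + (g x - h x))" by simp
  also have "\<dots> \<le> 2 * L2_norm_sq M (\<lambda>x. f x - g x) + 2 * L2_norm_sq M (\<lambda>x. g x - h x)"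
    by (intro L2_norm_sq_add_le L2_diff f L)
  also have "\<dots> < \<epsilon>" using g h by simp
  finally show "\<exists>g\<in>V. L2_norm_sq M (\<lambda>x. f x - g x) < \<epsilon>" using h by auto
qed

text \<open>A density criterion: a linear space of functions containing the constants and the
  indicators of an intersection-stable generator. Indicators need to agree with members of V only on
  the space, because functions of finitely many digits do not match them elsewhere.\<close>

locale L2_generating = prob_space M for M :: "'a measure" +
  fixes V :: "('a \<Rightarrow> complex) set" and G :: "'a set set"
  assumes V_L2: "V \<subseteq> L2 M"
    and V_add: "\<And>f g. f \<in> V \<Longrightarrow> g \<in> V \<Longrightarrow> (\<lambda>x. f x + g x) \<in> V"
    and V_cmult: "\<And>c f. f \<in> V \<Longrightarrow> (\<lambda>x. c * f x) \<in> V"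
    and V_one: "(\<lambda>x. 1) \<in> V"
    and V_gen: "\<And>A. A \<in> G \<Longrightarrow> \<exists>f\<in>V. \<forall>x\<in>space M. indicator A x = f x"
    and sets_gen: "sets M = sigma_sets (space M) G"
    and gen_stable: "Int_stable G" and gen_subset: "G \<subseteq> Pow (space M)"
begin

lemma closure_add:
  assumes "f \<in> L2_closure M V" "g \<in> L2_closure M V"
  shows "(\<lambda>x. f x + g x) \<in> L2_closure M V"
proof -
  have L: "f \<in> L2 M" "g \<in> L2 M" using assms by (auto simp: L2_closure_def)
  show ?thesis unfolding L2_closure_def
  proof (intro CollectI conjI L2_add L allI impI)
    fix \<epsilon> :: real assume "\<epsilon> > 0"
    then have "\<epsilon> / 4 > 0" by simp
    then obtain f' where f': "f' \<in> V" "L2_norm_sq M (\<lambda>x. f x - f' x) < \<epsilon> / 4"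
      by (rule L2_closureE[OF assms(1)])
    obtain g' where g': "g' \<in> V" "L2_norm_sq M (\<lambda>x. g x - g' x) < \<epsilon> / 4"
      using \<open>\<epsilon> / 4 > 0\<close> by (rule L2_closureE[OF assms(2)])
    note fg = f' g'
    have "L2_norm_sq M (\<lambda>x. f x + g x - (f' x + g' x)) = L2_norm_sq M (\<lambda>x. (f x - f' x) + (g x - g' x))"
      by (simp add: algebra_simps)
    also have "\<dots> \<le> 2 * L2_norm_sq M (\<lambda>x. f x - f' x) + 2 * L2_norm_sq M (\<lambda>x. g x - g' x)"
      using fg V_L2 L by (intro L2_norm_sq_add_le L2_diff) auto
    also have "\<dots> < \<epsilon>" using fg by simp
    finally show "\<exists>h\<in>V. L2_norm_sq M (\<lambda>x. f x + g x - h x) < \<epsilon>" using V_add fg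
      by (intro bexI[of _ "\<lambda>x. f' x + g' x"]) auto
  qed
qed

lemma closure_cmult:
  assumes "f \<in> L2_closure M V"
  shows "(\<lambda>x. c * f x) \<in> L2_closure M V"
proof -
  have L: "f \<in> L2 M" using assms by (auto simp: L2_closure_def)
  show ?thesis unfolding L2_closure_def
  proof (intro CollectI conjI L2_cmult L allI impI)
    fix \<epsilon> :: real assume "\<epsilon> > 0"
    \<comment> \<open>The added 1 covers the case c = 0.\<close>
    have c: "(cmod c)\<^sup>2 + 1 > 0" by (smt (verit) zero_le_power2)
    with \<open>\<epsilon> > 0\<close> have "\<epsilon> / ((cmod c)\<^sup>2 + 1) > 0" by simp
    then obtain f' where f': "f' \<in> V" "L2_norm_sq M (\<lambda>x. f x - f' x) < \<epsilon> / ((cmod c)\<^sup>2 + 1)"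
      by (rule L2_closureE[OF assms])
    have "L2_norm_sq M (\<lambda>x. c * f x - c * f' x) = (cmod c)\<^sup>2 * L2_norm_sq M (\<lambda>x. f x - f' x)"
      unfolding right_diff_distrib[symmetric] by (rule L2_norm_sq_cmult)
    also have "\<dots> \<le> ((cmod c)\<^sup>2 + 1) * L2_norm_sq M (\<lambda>x. f x - f' x)"
      by (intro mult_right_mono) (auto simp: L2_norm_sq_nonneg)
    also have "\<dots> < \<epsilon>" using f' c by (simp add: field_simps)
    finally show "\<exists>h\<in>V. L2_norm_sq M (\<lambda>x. c * f x - h x) < \<epsilon>" using V_cmult f'
      by (intro bexI[of _ "\<lambda>x. c * f' x"]) auto
  qed
qed

lemma closure_sum:
  "(\<And>i. i \<in> I \<Longrightarrow> f i \<in> L2_closure M V) \<Longrightarrow> (\<lambda>x. \<Sum>i\<in>I. f i x) \<in> L2_closure M V"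
proof (induction I rule: infinite_finite_induct)
  case (insert i I)
  then show ?case by (simp add: closure_add)
qed (use V_cmult[OF V_one, of 0] L2_closure_superset[OF V_L2] in auto)

lemma closure_cong:
  assumes "f \<in> L2_closure M V" "g \<in> borel_measurable M" "\<And>x. x \<in> space M \<Longrightarrow> g x = f x"
  shows "g \<in> L2_closure M V"
proof (rule L2_closure_idem[OF V_L2])
  have "integrable M (\<lambda>x. (cmod (g x))\<^sup>2) = integrable M (\<lambda>x. (cmod (f x))\<^sup>2)"
    using assms by (intro Bochner_Integration.integrable_cong) auto
  then show "g \<in> L2 M" using assms by (auto simp: L2_def L2_closure_def)
  have "L2_norm_sq M (\<lambda>x. g x - f x) = L2_norm_sq M (\<lambda>x. 0)"
    unfolding L2_norm_sq_def using assms by (intro Bochner_Integration.integral_cong) auto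
  then show "\<exists>h\<in>L2_closure M V. L2_norm_sq M (\<lambda>x. g x - h x) < \<epsilon>" if "\<epsilon> > 0" for \<epsilon>
    using assms that by (auto simp: L2_norm_sq_def intro!: bexI[of _ f])
qed

text \<open>The sets with indicator in the closure form a Dynkin system. Complements follow by
  linearity; for a disjoint union the squared error of the first n sets is the measure of the
  remainder, which decreases to 0.\<close>

lemma closure_indicator:
  assumes "A \<in> sets M"
  shows "(\<lambda>x. indicator A x) \<in> L2_closure M V"
  using gen_stable gen_subset assms[unfolded sets_gen]
proof (induction A rule: sigma_sets_induct_disjoint)
  case (basic A)
  from V_gen[OF this] obtain f where f: "f \<in> V" "\<forall>x\<in>space M. indicator A x = f x" ..
  have "f \<in> L2_closure M V" using f(1) L2_closure_superset[OF V_L2] ..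
  moreover have "A \<in> sets M" unfolding sets_gen using basic by (rule sigma_sets.Basic)
  then have "(\<lambda>x. indicator A x :: complex) \<in> borel_measurable M" by (rule borel_measurable_indicator)
  ultimately show ?case by (rule closure_cong) (use f in blast)
next
  case empty
  then show ?case using V_cmult[OF V_one, of 0] L2_closure_superset[OF V_L2] by auto
next
  case (compl A)
  then have A: "A \<in> sets M" by (simp add: sets_gen)
  have "(\<lambda>x. 1 + (- 1) * indicator A x) \<in> L2_closure M V"
    using V_one L2_closure_superset[OF V_L2] by (intro closure_add closure_cmult compl) auto
  then show ?case by (rule closure_cong) (use A in \<open>auto simp: indicator_def\<close>)
next
  case (union A)
  have A: "A i \<in> sets M" for i using union by (auto simp: sets_gen)
  have U: "(\<Union>i. A i) \<in> sets M" using A by auto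
  show ?case
  proof (rule L2_closure_idem[OF V_L2])
    show "(\<lambda>x. indicator (\<Union>i. A i) x) \<in> L2 M"
      by (intro L2_bounded[of _ 1] borel_measurable_indicator U) (simp add: indicator_def)
    fix \<epsilon> :: real assume "\<epsilon> > 0"
    define R where "R = (\<lambda>n. (\<Union>i. A i) - (\<Union>i<n. A i))"
    have R: "R n \<in> sets M" for n using A by (auto simp: R_def)
    have "(\<lambda>n. measure M (R n)) \<longlonglongrightarrow> measure M (\<Inter>n. R n)"
      using R by (intro finite_Lim_measure_decseq) (auto simp: R_def decseq_def)
    moreover have "(\<Inter>n. R n) = {}" by (auto simp: R_def)
    ultimately have "(\<lambda>n. measure M (R n)) \<longlonglongrightarrow> 0" by simp
    then obtain n where n: "measure M (R n) < \<epsilon>"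
      using \<open>\<epsilon> > 0\<close> by (fastforce dest!: order_tendstoD(2)[of _ _ _ \<epsilon>] simp: eventually_sequentially)
    have "indicator (\<Union>i<n. A i) x = (\<Sum>i<n. indicator (A i) x :: complex)" for x
      using union(1) by (intro indicator_UN_disjoint) (auto simp: disjoint_family_on_def)
    moreover have "indicator (\<Union>i. A i) x - indicator (\<Union>i<n. A i) x = (indicator (R n) x :: complex)" for x
      by (auto simp: R_def indicator_def)
    ultimately have "L2_norm_sq M (\<lambda>x. indicator (\<Union>i. A i) x - (\<Sum>i<n. indicator (A i) x))
       = L2_norm_sq M (\<lambda>x. indicator (R n) x)" by simp
    also have "\<dots> = (\<integral>x. indicator (R n) x \<partial>M)"
      unfolding L2_norm_sq_def by (intro Bochner_Integration.integral_cong) (auto simp: indicator_def)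
    also have "\<dots> = measure M (R n)" using R by (simp add: Int_absorb2 sets.sets_into_space)
    finally show "\<exists>g\<in>L2_closure M V. L2_norm_sq M (\<lambda>x. indicator (\<Union>i. A i) x - g x) < \<epsilon>"
      using n union by (intro bexI[of _ "\<lambda>x. \<Sum>i<n. indicator (A i) x"] closure_sum) auto
  qed
qed

lemma closure_simple_function:
  fixes f :: "'a \<Rightarrow> complex"
  assumes "simple_function M f"
  shows "f \<in> L2_closure M V"
proof -
  have fin: "finite (f ` space M)" using assms by (simp add: simple_function_def)
  have "(\<lambda>x. \<Sum>y\<in>f ` space M. y * indicator (f -` {y} \<inter> space M) x) \<in> L2_closure M V"
    using assms by (intro closure_sum closure_cmult closure_indicator) (auto simp: simple_function_def)
  then show ?thesis
  proof (rule closure_cong)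
    show "f \<in> borel_measurable M" using assms by (rule borel_measurable_simple_function)
    fix x assume x: "x \<in> space M"
    have "(\<Sum>y\<in>f ` space M. y * indicator (f -` {y} \<inter> space M) x)
        = (\<Sum>y\<in>f ` space M. if y = f x then y else 0)"
      using x by (intro sum.cong) (auto simp: indicator_def)
    also have "\<dots> = f x" using fin x by (simp add: sum.delta)
    finally show "f x = (\<Sum>y\<in>f ` space M. y * indicator (f -` {y} \<inter> space M) x)" ..
  qed
qed

theorem closure_eq_L2: "L2_closure M V = L2 M"
proof
  show "L2 M \<subseteq> L2_closure M V"
  proof
    fix f assume f: "f \<in> L2 M"
    then have fm: "f \<in> borel_measurable M" by (simp add: L2_def)
    from borel_measurable_implies_sequence_metric[OF this, of 0] obtain F where
      F: "\<And>i. simple_function M (F i)" "\<And>x. x \<in> space M \<Longrightarrow> (\<lambda>i. F i x) \<longlonglongrightarrow> f x"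
      "\<And>i x. x \<in> space M \<Longrightarrow> dist (F i x) 0 \<le> 2 * dist (f x) 0" by blast
    have Fm: "F i \<in> borel_measurable M" for i by (rule borel_measurable_simple_function[OF F(1)])
    have "(\<lambda>i. L2_norm_sq M (\<lambda>x. f x - F i x)) \<longlonglongrightarrow> (\<integral>x. 0 \<partial>M)"
      unfolding L2_norm_sq_def
    proof (rule integral_dominated_convergence)
      \<comment> \<open>Since |F i| \<le> 2 |f|, the error is at most 3 |f|, hence the factor
        9.\<close>
      show "integrable M (\<lambda>x. 9 * (cmod (f x))\<^sup>2)" using f by (simp add: L2_def)
      show "AE x in M. (\<lambda>i. (cmod (f x - F i x))\<^sup>2) \<longlonglongrightarrow> 0"
      proof (intro AE_I2)
        fix x assume "x \<in> space M"
        then have "(\<lambda>i. (cmod (f x - F i x))\<^sup>2) \<longlonglongrightarrow> (cmod (f x - f x))\<^sup>2"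
          by (intro tendsto_intros F(2))
        then show "(\<lambda>i. (cmod (f x - F i x))\<^sup>2) \<longlonglongrightarrow> 0" by simp
      qed
      show "AE x in M. norm ((cmod (f x - F i x))\<^sup>2) \<le> 9 * (cmod (f x))\<^sup>2" for i
      proof (intro AE_I2)
        fix x assume x: "x \<in> space M"
        have "cmod (f x - F i x) \<le> cmod (f x) + cmod (F i x)" by (rule norm_triangle_ineq4)
        also have "\<dots> \<le> 3 * cmod (f x)" using F(3)[OF x, of i] by simp
        finally have "(cmod (f x - F i x))\<^sup>2 \<le> (3 * cmod (f x))\<^sup>2" by (intro power_mono) auto
        then show "norm ((cmod (f x - F i x))\<^sup>2) \<le> 9 * (cmod (f x))\<^sup>2" by (simp add: power_mult_distrib)
      qed
    qed (use fm Fm in measurable)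
    then have lim: "(\<lambda>i. L2_norm_sq M (\<lambda>x. f x - F i x)) \<longlonglongrightarrow> 0" by simp
    show "f \<in> L2_closure M V"
    proof (rule L2_closure_idem[OF V_L2 f])
      fix \<epsilon> :: real assume "\<epsilon> > 0"
      then obtain i where "L2_norm_sq M (\<lambda>x. f x - F i x) < \<epsilon>"
        using lim by (fastforce dest!: order_tendstoD(2)[of _ _ _ \<epsilon>] simp: eventually_sequentially)
      then show "\<exists>g\<in>L2_closure M V. L2_norm_sq M (\<lambda>x. f x - g x) < \<epsilon>"
        using closure_simple_function[OF F(1)] by blast
    qed
  qed
qed (auto simp: L2_closure_def)

end

section \<open>The digit space\<close>

text \<open>This is uniqueness of weak limits, without which the description in
  \<open>inf_convolution\<close> would not determine the measure. The indicator of a closed set is a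
  pointwise limit of the bounded continuous functions \<open>g C k\<close>, and closed sets form an
  intersection-stable generator. The empty set is treated apart because the distance to it is 0 by
  convention.\<close>

lemma finite_measure_eqI_continuous:
  fixes M N :: "'a::metric_space measure"
  assumes M: "finite_measure M" "sets M = sets borel" and N: "finite_measure N" "sets N = sets borel"
    and eq: "\<And>f :: 'a \<Rightarrow> real. continuous_on UNIV f \<Longrightarrow> bounded (range f) \<Longrightarrow> integral\<^sup>L M f = integral\<^sup>L N f"
  shows "M = N"
proof -
  define g where "g = (\<lambda>C k (x::'a). max 0 (1 - real k * infdist x C))"
  have g_cont: "continuous_on UNIV (g C k)" for C k
    unfolding g_def by (intro continuous_intros)
  have g_bound: "\<bar>g C k x\<bar> \<le> 1" for C k x
    unfolding g_def by (simp add: infdist_nonneg)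
  have lim: "(\<lambda>k. integral\<^sup>L K (g C k)) \<longlonglongrightarrow> measure K C"
    if K: "finite_measure K" "sets K = sets borel" and C: "closed C" "C \<noteq> {}" for K C
  proof -
    interpret K: finite_measure K by fact
    have CK: "C \<in> sets K" using C K by simp
    have "(\<lambda>k. integral\<^sup>L K (g C k)) \<longlonglongrightarrow> integral\<^sup>L K (indicator C)"
    proof (rule integral_dominated_convergence)
      show "integrable K (\<lambda>x. 1 :: real)" by simp
      show "AE x in K. (\<lambda>k. g C k x) \<longlonglongrightarrow> indicator C x"
      proof (intro AE_I2)
        fix x
        show "(\<lambda>k. g C k x) \<longlonglongrightarrow> indicator C x"
        proof (cases "x \<in> C")
          case True
          then show ?thesis by (simp add: g_def)
        next
          case False
          then have pos: "infdist x C > 0"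
            using C in_closed_iff_infdist_zero[of C x] infdist_nonneg[of x C] by auto
          then obtain K where K: "real K * infdist x C > 1"
            using reals_Archimedean3 by blast
          have "g C k x = 0" if "k \<ge> K" for k
          proof -
            have "real K * infdist x C \<le> real k * infdist x C"
              using that pos by (intro mult_right_mono) auto
            then show ?thesis using K by (simp add: g_def)
          qed
          then show ?thesis using False
            by (intro tendsto_eventually) (auto simp: eventually_sequentially)
        qed
      qed
      show "g C k \<in> borel_measurable K" for k
        using borel_measurable_continuous_onI[OF g_cont] K(2) measurable_cong_sets by blast
      show "indicator C \<in> borel_measurable K" using CK by measurable
    qed (simp add: g_bound)
    then show ?thesis using CK by (simp add: Int_absorb2 sets.sets_into_space)
  qed
  have "bounded (range (g C k))" for C k
    unfolding bounded_iff using g_bound[of C k] by auto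
  then have meas: "measure M C = measure N C" if "closed C" "C \<noteq> {}" for C
    using lim[OF M that] lim[OF N that] eq[OF g_cont] LIMSEQ_unique by fastforce
  interpret M: finite_measure M by fact
  interpret N: finite_measure N by fact
  show ?thesis
  proof (rule measure_eqI_generator_eq[where E = "Collect closed" and \<Omega> = UNIV and A = "\<lambda>_. UNIV"])
    show "emeasure M X = emeasure N X" if "X \<in> Collect closed" for X
      using meas[of X] that by (cases "X = {}") (auto simp: M.emeasure_eq_measure N.emeasure_eq_measure)
    show "sets M = sigma_sets UNIV (Collect closed)" "sets N = sigma_sets UNIV (Collect closed)"
      using M N by (simp_all add: borel_eq_closed)
  qed (auto simp: Int_stable_def)
qed

lemma inf_convolution_eqI:
  assumes "is_inf_convolution \<nu> N"
  shows "inf_convolution \<nu> = N"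
  unfolding inf_convolution_def
proof (rule the_equality[of "is_inf_convolution \<nu>", OF assms])
  fix N' assume N': "is_inf_convolution \<nu> N'"
  show "N' = N"
  proof (rule finite_measure_eqI_continuous)
    fix f :: "real ^ 'a \<Rightarrow> real"
    assume f: "continuous_on UNIV f" "bounded (range f)"
    show "integral\<^sup>L N' f = integral\<^sup>L N f"
      using N' assms f LIMSEQ_unique unfolding is_inf_convolution_def weakly_converges_def by blast
  qed (use N' assms in \<open>auto simp: is_inf_convolution_def prob_space.finite_measure\<close>)
qed

lemma unif_dirac_image:
  assumes "finite A" "A \<noteq> {}" "inj_on f A"
  shows "unif_dirac (f ` A) = distr (uniform_count_measure A) borel f"
proof (rule measure_eqI)
  fix X assume "X \<in> sets (unif_dirac (f ` A))"
  then have X: "X \<in> sets borel" by (simp add: unif_dirac_def)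
  have f: "f \<in> borel_measurable (uniform_count_measure A)"
    by (simp add: measurable_def sets_uniform_count_measure space_uniform_count_measure)
  have "emeasure (unif_dirac (f ` A)) X = ennreal (card (f ` A \<inter> X) / card (f ` A))"
    using X assms by (simp add: unif_dirac_def emeasure_distr emeasure_pmf_of_set)
  also have "f ` A \<inter> X = f ` (f -` X \<inter> A)" by auto
  also have "card \<dots> = card (f -` X \<inter> A)"
    using assms by (intro card_image) (auto intro: inj_on_subset)
  also have "card (f ` A) = card A" using assms by (simp add: card_image)
  also have "ennreal (card (f -` X \<inter> A) / card A) = emeasure (distr (uniform_count_measure A) borel f) X"
    using X f assms by (simp add: emeasure_distr space_uniform_count_measure emeasure_uniform_count_measure)
  finally show "emeasure (unif_dirac (f ` A)) X = emeasure (distr (uniform_count_measure A) borel f) X" .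
qed (simp add: unif_dirac_def)

definition digit_space :: "(nat \<Rightarrow> 'a set) \<Rightarrow> (nat \<Rightarrow> 'a) measure"
  where "digit_space B = (\<Pi>\<^sub>M k\<in>{1..}. uniform_count_measure (B k))"

locale digit_system =
  fixes R :: "nat \<Rightarrow> int ^ 'n::finite ^ 'n" and B :: "nat \<Rightarrow> (int ^ 'n) set"
  assumes inv: "\<forall>k\<ge>1. invertible (rmat (R k))"
    and fin: "finite (B k)" and zero: "0 \<in> B k"
    and series: "tower_series_converge R B"
begin

abbreviation U :: "nat \<Rightarrow> (int ^ 'n) measure" where "U k \<equiv> uniform_count_measure (B k)"
abbreviation \<Omega> :: "(nat \<Rightarrow> int ^ 'n) measure" where "\<Omega> \<equiv> digit_space B"
abbreviation past :: "nat \<Rightarrow> (nat \<Rightarrow> int ^ 'n) \<Rightarrow> nat \<Rightarrow> int ^ 'n" where "past n \<omega> \<equiv> restrict \<omega> {1..n}"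
abbreviation future :: "nat \<Rightarrow> (nat \<Rightarrow> int ^ 'n) \<Rightarrow> nat \<Rightarrow> int ^ 'n" where "future n \<omega> \<equiv> restrict \<omega> {n<..}"
abbreviation words :: "nat \<Rightarrow> (nat \<Rightarrow> int ^ 'n) set" where "words n \<equiv> \<Pi>\<^sub>E k\<in>{1..n}. B k"

text \<open>\<open>tail_sum 0\<close> is the random point \<open>X\<close>. The shift by n + 1 makes
  the sum run over exactly the indices above n.\<close>

definition tail_sum :: "nat \<Rightarrow> (nat \<Rightarrow> int ^ 'n) \<Rightarrow> real ^ 'n"
  where "tail_sum n \<omega> = (\<Sum>k. cum_inv R (n + k + 1) (\<omega> (n + k + 1)))"

lemma prob_U: "prob_space (U k)"
  using fin zero by (intro prob_space_uniform_count_measure) auto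

sublocale prob_space \<Omega>
  unfolding digit_space_def by (intro prob_space_PiM prob_U)

lemma space_digit_space: "space \<Omega> = (\<Pi>\<^sub>E k\<in>{1..}. B k)"
  by (simp add: digit_space_def space_PiM space_uniform_count_measure)

lemma measurable_U: "f \<in> borel_measurable (U k)"
  by (simp add: measurable_def sets_uniform_count_measure space_uniform_count_measure)

lemma cum_inv_measurable:
  assumes "k \<in> J"
  shows "(\<lambda>\<omega>. cum_inv R k (\<omega> k)) \<in> borel_measurable (Pi\<^sub>M J U)"
  by (rule measurable_compose[OF measurable_component_singleton[OF assms] measurable_U])

lemma tail_sum_measurable: "{n<..} \<subseteq> J \<Longrightarrow> tail_sum n \<in> borel_measurable (Pi\<^sub>M J U)"
  unfolding tail_sum_def by (intro borel_measurable_suminf cum_inv_measurable) auto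

lemma tail_sum_future: "tail_sum n (future n \<omega>) = tail_sum n \<omega>"
  by (simp add: tail_sum_def)

lemma summable_digits:
  assumes "\<And>k. k > n \<Longrightarrow> b k \<in> B k"
  shows "summable (\<lambda>k. cum_inv R (n + k + 1) (b (n + k + 1)))"
proof -
  \<comment> \<open>Padding with the digit 0 turns a sequence prescribed only beyond n into an
    admissible full sequence with the same tail.\<close>
  define b' where "b' = (\<lambda>k. if k \<le> n then 0 else b k)"
  have "\<forall>k\<ge>1. b' k \<in> B k" using assms zero by (auto simp: b'_def)
  then have "summable (\<lambda>k. cum_inv R (k + 1) (b' (k + 1)))"
    using series unfolding tower_series_converge_def by blast
  then have "summable (\<lambda>k. cum_inv R (k + n + 1) (b' (k + n + 1)))"
    by (rule summable_ignore_initial_segment)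
  then show ?thesis by (simp add: b'_def add_ac)
qed

lemma tail_sum_0:
  assumes "\<omega> \<in> space \<Omega>"
  shows "tail_sum 0 \<omega> = digit_sum R n (past n \<omega>) + tail_sum n \<omega>"
proof -
  have "summable (\<lambda>k. cum_inv R (k + 1) (\<omega> (k + 1)))"
    using summable_digits[of 0 \<omega>] assms by (auto simp: space_digit_space PiE_iff)
  then have "tail_sum 0 \<omega> = tail_sum n \<omega> + (\<Sum>k<n. cum_inv R (k + 1) (\<omega> (k + 1)))"
    unfolding tail_sum_def by (subst suminf_split_initial_segment[where k = n]) (auto simp: add_ac)
  also have "(\<Sum>k<n. cum_inv R (k + 1) (\<omega> (k + 1))) = digit_sum R n (past n \<omega>)"
    unfolding digit_sum_def by (rule sum.reindex_bij_witness[of _ "\<lambda>k. k - 1" Suc]) auto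
  finally show ?thesis by (simp add: add.commute)
qed

text \<open>Independence is read off the joint law: on the product space the coordinates have the
  product measure itself as joint law, and its marginals are the \<open>U k\<close>.\<close>

lemma indep_digits: "indep_vars U (\<lambda>k \<omega>. \<omega> k) {1..}"
proof -
  have "distr \<Omega> (\<Pi>\<^sub>M k\<in>{1..}. U k) (\<lambda>\<omega>. \<lambda>k\<in>{1..}. \<omega> k) = distr \<Omega> \<Omega> (\<lambda>\<omega>. \<omega>)"
    by (intro distr_cong) (auto simp: digit_space_def space_PiM)
  also have "\<dots> = (\<Pi>\<^sub>M k\<in>{1..}. U k)" by (simp add: digit_space_def)
  also have "\<dots> = (\<Pi>\<^sub>M k\<in>{1..}. distr \<Omega> (U k) (\<lambda>\<omega>. \<omega> k))"
    unfolding digit_space_def by (intro PiM_cong refl distr_PiM_component[OF prob_U, symmetric])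
  finally show ?thesis
    by (subst indep_vars_iff_distr_eq_PiM') (auto simp: digit_space_def)
qed

lemma indep_past_future:
  "indep_var (\<Pi>\<^sub>M k\<in>{1..n}. U k) (past n) (\<Pi>\<^sub>M k\<in>{n<..}. U k) (future n)"
  by (rule indep_var_restrict[OF indep_digits]) auto

lemma past_measurable: "past n \<in> measurable \<Omega> (\<Pi>\<^sub>M k\<in>{1..n}. U k)"
  unfolding digit_space_def by (rule measurable_restrict_subset) auto

lemma future_measurable: "future n \<in> measurable \<Omega> (\<Pi>\<^sub>M k\<in>{n<..}. U k)"
  unfolding digit_space_def by (rule measurable_restrict_subset) auto

lemma past_words: "\<omega> \<in> space \<Omega> \<Longrightarrow> past n \<omega> \<in> words n"
  by (auto simp: space_digit_space PiE_iff)

lemma finite_words: "finite (words n)"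
  using fin by (intro finite_PiE) auto

lemma sets_words: "X \<subseteq> words n \<Longrightarrow> X \<in> sets (\<Pi>\<^sub>M k\<in>{1..n}. U k)"
proof -
  assume X: "X \<subseteq> words n"
  have "{b} \<in> sets (\<Pi>\<^sub>M k\<in>{1..n}. U k)" if "b \<in> words n" for b
  proof -
    have "{b} = (\<Pi>\<^sub>E k\<in>{1..n}. {b k})" using that by (simp add: PiE_singleton PiE_iff)
    also have "\<dots> \<in> sets (\<Pi>\<^sub>M k\<in>{1..n}. U k)"
      using that by (intro sets_PiM_I_finite) (auto simp: sets_uniform_count_measure PiE_iff)
    finally show ?thesis .
  qed
  then have "(\<Union>b\<in>X. {b}) \<in> sets (\<Pi>\<^sub>M k\<in>{1..n}. U k)"
    using X finite_subset[OF X finite_words] by (intro sets.finite_UN) auto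
  then show ?thesis by simp
qed

lemma words_measurable: "w \<in> borel_measurable (\<Pi>\<^sub>M k\<in>{1..n}. U k)"
proof (rule measurableI)
  show "w -` A \<inter> space (\<Pi>\<^sub>M k\<in>{1..n}. U k) \<in> sets (\<Pi>\<^sub>M k\<in>{1..n}. U k)" for A
    by (rule sets_words) (auto simp: space_PiM space_uniform_count_measure)
qed simp

text \<open>All words of length n are equally likely, because fixing the first n digits is a finite
  box in the product space; expectations of functions of the past are therefore averages over
  words.\<close>

lemma expectation_past:
  fixes w :: "(nat \<Rightarrow> int ^ 'n) \<Rightarrow> complex"
  shows "integrable \<Omega> (\<lambda>\<omega>. w (past n \<omega>))"
    and "(\<integral>\<omega>. w (past n \<omega>) \<partial>\<Omega>) = (\<Sum>b\<in>words n. w b) / (\<Prod>k=1..n. of_nat (card (B k)))"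
proof -
  let ?E = "\<lambda>b. past n -` {b} \<inter> space \<Omega>"
  have E: "?E b \<in> sets \<Omega>" if "b \<in> words n" for b
    by (rule measurable_sets[OF past_measurable sets_words]) (use that in auto)
  have w: "w (past n \<omega>) = (\<Sum>b\<in>words n. w b * indicator (?E b) \<omega>)" if "\<omega> \<in> space \<Omega>" for \<omega>
  proof -
    have "(\<Sum>b\<in>words n. w b * indicator (?E b) \<omega>) = (\<Sum>b\<in>words n. if b = past n \<omega> then w b else 0)"
      using that by (intro sum.cong) (auto simp: indicator_def)
    also have "\<dots> = w (past n \<omega>)" using past_words[OF that] finite_words by (simp add: sum.delta)
    finally show ?thesis ..
  qed
  have int: "integrable \<Omega> (\<lambda>\<omega>. w b * indicator (?E b) \<omega>)" if "b \<in> words n" for b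
    using E[OF that] by (intro integrable_mult_right integrable_real_indicator[THEN integrable_of_real, where 'a = complex, unfolded of_real_indicator]) (auto simp: emeasure_eq_measure)
  have meas: "measure \<Omega> (?E b) = 1 / (\<Prod>k=1..n. real (card (B k)))" if b: "b \<in> words n" for b
  proof -
    have "?E b = prod_emb {1..} U {1..n} (\<Pi>\<^sub>E k\<in>{1..n}. {b k})"
      using b by (auto simp: prod_emb_def digit_space_def space_PiM PiE_singleton PiE_iff)
    then have "emeasure \<Omega> (?E b) = (\<Prod>k=1..n. emeasure (U k) {b k})"
      unfolding digit_space_def using b
      by (simp, subst emeasure_PiM_emb) (auto simp: prob_U sets_uniform_count_measure PiE_iff)
    also have "\<dots> = (\<Prod>k=1..n. ennreal (1 / card (B k)))"
      using b fin by (intro prod.cong) (auto simp: emeasure_uniform_count_measure PiE_iff)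
    also have "\<dots> = ennreal (\<Prod>k=1..n. 1 / card (B k))" by (rule prod_ennreal) auto
    finally show ?thesis by (simp add: measure_def prod_dividef prod_nonneg)
  qed
  show "integrable \<Omega> (\<lambda>\<omega>. w (past n \<omega>))"
    using int by (subst Bochner_Integration.integrable_cong[OF refl w]) auto
  have "(\<integral>\<omega>. w (past n \<omega>) \<partial>\<Omega>) = (\<integral>\<omega>. (\<Sum>b\<in>words n. w b * indicator (?E b) \<omega>) \<partial>\<Omega>)"
    by (intro Bochner_Integration.integral_cong w) auto
  also have "\<dots> = (\<Sum>b\<in>words n. \<integral>\<omega>. w b * indicator (?E b) \<omega> \<partial>\<Omega>)"
    by (rule Bochner_Integration.integral_sum) (rule int)
  also have "\<dots> = (\<Sum>b\<in>words n. w b * of_real (measure \<Omega> (?E b)))"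
  proof (intro sum.cong refl)
    fix b assume b: "b \<in> words n"
    have "(\<integral>\<omega>. (indicator (?E b) \<omega> :: complex) \<partial>\<Omega>) = (\<integral>\<omega>. complex_of_real (indicator (?E b) \<omega>) \<partial>\<Omega>)"
      by (simp add: of_real_indicator)
    also have "\<dots> = of_real (measure \<Omega> (?E b))"
      using E[OF b] by (subst integral_complex_of_real) simp
    finally show "(\<integral>\<omega>. w b * indicator (?E b) \<omega> \<partial>\<Omega>) = w b * of_real (measure \<Omega> (?E b))"
      by (simp del: Bochner_Integration.integral_indicator)
  qed
  also have "\<dots> = (\<Sum>b\<in>words n. w b) / (\<Prod>k=1..n. of_nat (card (B k)))"
    unfolding sum_divide_distrib by (intro sum.cong refl) (simp add: meas del: One_nat_def)
  finally show "(\<integral>\<omega>. w (past n \<omega>) \<partial>\<Omega>) = (\<Sum>b\<in>words n. w b) / (\<Prod>k=1..n. of_nat (card (B k)))" .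
qed

lemma expectation_past_future:
  fixes w \<phi> :: "(nat \<Rightarrow> int ^ 'n) \<Rightarrow> complex"
  assumes \<phi>: "\<phi> \<in> borel_measurable (\<Pi>\<^sub>M k\<in>{n<..}. U k)" "\<And>\<omega>. cmod (\<phi> \<omega>) \<le> 1"
  shows "(\<integral>\<omega>. w (past n \<omega>) * \<phi> (future n \<omega>) \<partial>\<Omega>)
    = (\<Sum>b\<in>words n. w b) / (\<Prod>k=1..n. of_nat (card (B k))) * (\<integral>\<omega>. \<phi> (future n \<omega>) \<partial>\<Omega>)"
proof -
  have "integrable \<Omega> (\<lambda>\<omega>. \<phi> (future n \<omega>))"
    using \<phi> by (intro integrable_const_bound[of _ 1] measurable_compose[OF future_measurable]) auto
  moreover have "indep_var borel (\<lambda>\<omega>. w (past n \<omega>)) borel (\<lambda>\<omega>. \<phi> (future n \<omega>))"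
    using indep_var_compose[OF indep_past_future words_measurable \<phi>(1)] by (simp add: comp_def)
  ultimately show ?thesis
    using indep_var_lebesgue_integral[of "\<lambda>\<omega>. w (past n \<omega>)" "\<lambda>\<omega>. \<phi> (future n \<omega>)"] expectation_past
    by simp
qed

section \<open>Convolutions as laws of digit sums\<close>

lemma cum_inv_inj: "inj_on (cum_inv R k) A"
proof (rule inj_onI)
  fix a b assume "cum_inv R k a = cum_inv R k b"
  then have "rmat (cum_mat R k) *v cum_inv R k a = rmat (cum_mat R k) *v cum_inv R k b" by simp
  then have "rvec a = rvec b"
    unfolding cum_inv_def matrix_mul_inv_vec(1)[OF invertible_cum_mat[OF inv]] .
  then show "a = b" by (simp add: rvec_def vec_eq_iff)
qed

text \<open>Sums of independent variables have convolved laws: the first m summands use digits up to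
  n + m, the next one a later digit. Injectivity of \<open>cum_inv R k\<close> makes the uniform law
  on the image points the law of the scaled digit.\<close>

lemma fin_convolution_tower:
  "fin_convolution (tower_factors R B n) m
    = distr \<Omega> borel (\<lambda>\<omega>. \<Sum>k<m. cum_inv R (n + k + 1) (\<omega> (n + k + 1)))"
proof (induction m)
  case 0
  have "distr \<Omega> borel (\<lambda>\<omega>. 0 :: real ^ 'n) = return borel 0" by (rule distr_const) simp
  then show ?case by simp
next
  case (Suc m)
  let ?K = "n + m + 1"
  let ?S = "\<lambda>\<omega>. \<Sum>k<m. cum_inv R (n + k + 1) (\<omega> (n + k + 1))"
  have 1: "(\<lambda>\<omega>. ?S \<omega>) \<in> borel_measurable (\<Pi>\<^sub>M k\<in>{1..n + m}. U k)" by (rule words_measurable)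
  have 2: "(\<lambda>\<omega>. cum_inv R ?K (\<omega> ?K)) \<in> borel_measurable (\<Pi>\<^sub>M k\<in>{n + m<..}. U k)"
    by (rule cum_inv_measurable) simp
  have eq: "?S (past (n + m) \<omega>) = ?S \<omega>" for \<omega> by (intro sum.cong) auto
  have "indep_var borel (\<lambda>\<omega>. ?S (past (n + m) \<omega>)) borel (\<lambda>\<omega>. cum_inv R ?K (future (n + m) \<omega> ?K))"
    using indep_var_compose[OF indep_past_future 1 2] by (simp add: comp_def)
  then have ind: "indep_var borel ?S borel (\<lambda>\<omega>. cum_inv R ?K (\<omega> ?K))"
    unfolding eq by simp
  have m: "?S \<in> borel_measurable \<Omega>" "(\<lambda>\<omega>. cum_inv R ?K (\<omega> ?K)) \<in> borel_measurable \<Omega>"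
    unfolding digit_space_def by (auto intro!: borel_measurable_sum cum_inv_measurable)
  have "distr \<Omega> borel (\<lambda>\<omega>. cum_inv R ?K (\<omega> ?K)) = distr (distr \<Omega> (U ?K) (\<lambda>\<omega>. \<omega> ?K)) borel (cum_inv R ?K)"
    by (subst distr_distr) (auto simp: comp_def measurable_U digit_space_def)
  also have "distr \<Omega> (U ?K) (\<lambda>\<omega>. \<omega> ?K) = U ?K"
    unfolding digit_space_def by (rule distr_PiM_component) (auto simp: prob_U)
  also have "distr (U ?K) borel (cum_inv R ?K) = tower_factors R B n m"
    unfolding tower_factors_def using fin zero[of ?K] cum_inv_inj
    by (intro unif_dirac_image[symmetric]) blast+
  finally show ?case
    using sum_indep_random_variable[OF ind m] Suc.IH by simp
qed

text \<open>The partial sums converge at every point of the digit space, so dominated convergence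
  gives weak convergence of their laws, and the weak limit is unique.\<close>

lemma tower_tail_eq: "tower_tail R B n = distr \<Omega> borel (tail_sum n)"
  unfolding tower_tail_def
proof (rule inf_convolution_eqI)
  have m: "tail_sum n \<in> borel_measurable \<Omega>"
    unfolding digit_space_def by (rule tail_sum_measurable) auto
  let ?S = "\<lambda>m \<omega>. \<Sum>k<m. cum_inv R (n + k + 1) (\<omega> (n + k + 1))"
  have mS: "?S m \<in> borel_measurable \<Omega>" for m
    unfolding digit_space_def by (intro borel_measurable_sum cum_inv_measurable) auto
  show "is_inf_convolution (tower_factors R B n) (distr \<Omega> borel (tail_sum n))"
    unfolding is_inf_convolution_def weakly_converges_def fin_convolution_tower
  proof (intro conjI allI impI)
    show "prob_space (distr \<Omega> borel (tail_sum n))" using m by (rule prob_space_distr)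
    fix f :: "real ^ 'n \<Rightarrow> real"
    assume f: "continuous_on UNIV f" "bounded (range f)"
    then obtain K where K: "\<And>x. \<bar>f x\<bar> \<le> K" unfolding bounded_iff by auto
    have fm: "f \<in> borel_measurable borel" using f(1) by (rule borel_measurable_continuous_onI)
    have "(\<lambda>m. \<integral>\<omega>. f (?S m \<omega>) \<partial>\<Omega>) \<longlonglongrightarrow> (\<integral>\<omega>. f (tail_sum n \<omega>) \<partial>\<Omega>)"
    proof (rule integral_dominated_convergence)
      show "integrable \<Omega> (\<lambda>\<omega>. K)" by simp
      show "AE \<omega> in \<Omega>. (\<lambda>m. f (?S m \<omega>)) \<longlonglongrightarrow> f (tail_sum n \<omega>)"
      proof (intro AE_I2)
        fix \<omega> assume "\<omega> \<in> space \<Omega>"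
        then have "(\<lambda>m. ?S m \<omega>) \<longlonglongrightarrow> tail_sum n \<omega>" unfolding tail_sum_def
          by (intro summable_LIMSEQ summable_digits) (auto simp: space_digit_space PiE_iff)
        then show "(\<lambda>m. f (?S m \<omega>)) \<longlonglongrightarrow> f (tail_sum n \<omega>)"
          using f(1) by (intro continuous_on_tendsto_compose[OF f(1)]) auto
      qed
    qed (use K measurable_compose[OF m fm] measurable_compose[OF mS fm] in auto)
    then show "(\<lambda>m. integral\<^sup>L (distr \<Omega> borel (?S m)) f) \<longlonglongrightarrow> integral\<^sup>L (distr \<Omega> borel (tail_sum n)) f"
      using m mS fm by (simp add: integral_distr)
  qed simp
qed

section \<open>Exponentials against functions of finitely many digits\<close>

lemma expo_measurable: "expo l \<in> borel_measurable borel"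
  unfolding expo_def by (intro borel_measurable_continuous_onI continuous_intros)

lemma fourier_tower_tail:
  "fourier (tower_tail R B n) (rvec l) = (\<integral>\<omega>. cnj (expo l (tail_sum n \<omega>)) \<partial>\<Omega>)"
proof -
  have m: "tail_sum n \<in> borel_measurable \<Omega>"
    unfolding digit_space_def by (rule tail_sum_measurable) auto
  have "fourier (tower_tail R B n) (rvec l) = (\<integral>x. cnj (expo l x) \<partial>distr \<Omega> borel (tail_sum n))"
    by (simp add: fourier_def tower_tail_eq expo_def cis_cnj)
  also have "\<dots> = (\<integral>\<omega>. cnj (expo l (tail_sum n \<omega>)) \<partial>\<Omega>)"
    using m by (intro integral_distr) (auto intro: borel_measurable_cnj expo_measurable)
  finally show ?thesis .
qed

text \<open>Valid for every frequency l: exponentials turn the splitting of \<open>X\<close> into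
  past and tail into a product, which independence integrates factor by factor. Membership in
  \<open>Lambda_n\<close> matters only when the two factors are estimated.\<close>

lemma inner_cylinder_expo:
  "L2_inner \<Omega> (\<lambda>\<omega>. w (past n \<omega>)) (\<lambda>\<omega>. expo l (tail_sum 0 \<omega>))
    = (\<Sum>b\<in>words n. w b * cnj (expo l (digit_sum R n b))) / (\<Prod>k=1..n. of_nat (card (B k)))
      * fourier (tower_tail R B n) (rvec l)"
proof -
  let ?\<phi> = "\<lambda>\<omega>. cnj (expo l (tail_sum n \<omega>))"
  have "L2_inner \<Omega> (\<lambda>\<omega>. w (past n \<omega>)) (\<lambda>\<omega>. expo l (tail_sum 0 \<omega>))
     = (\<integral>\<omega>. (w (past n \<omega>) * cnj (expo l (digit_sum R n (past n \<omega>)))) * ?\<phi> (future n \<omega>) \<partial>\<Omega>)"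
    unfolding L2_inner_def tail_sum_future
    by (intro Bochner_Integration.integral_cong) (simp_all add: tail_sum_0[of _ n] expo_add)
  also have "\<dots> = (\<Sum>b\<in>words n. w b * cnj (expo l (digit_sum R n b))) / (\<Prod>k=1..n. of_nat (card (B k)))
      * (\<integral>\<omega>. ?\<phi> (future n \<omega>) \<partial>\<Omega>)"
    by (rule expectation_past_future[where w = "\<lambda>b. w b * cnj (expo l (digit_sum R n b))"])
      (auto intro!: borel_measurable_cnj measurable_compose[OF tail_sum_measurable expo_measurable])
  finally show ?thesis unfolding tail_sum_future fourier_tower_tail .
qed

lemma fourier_tower_tail_le: "cmod (fourier (tower_tail R B n) (rvec l)) \<le> 1"
proof -
  have "cmod (fourier (tower_tail R B n) (rvec l)) \<le> (\<integral>\<omega>. cmod (cnj (expo l (tail_sum n \<omega>))) \<partial>\<Omega>)"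
    unfolding fourier_tower_tail by (rule integral_norm_bound)
  then show ?thesis by (simp add: prob_space)
qed

text \<open>No measurability or size condition is imposed on w: there are finitely many words of
  length n, so every function of them is measurable and bounded.\<close>

definition cylinder :: "((nat \<Rightarrow> int ^ 'n) \<Rightarrow> complex) set"
  where "cylinder = {(\<lambda>\<omega>. w (past n \<omega>)) | n w. True}"

lemma cylinderI: "(\<lambda>\<omega>. w (past n \<omega>)) \<in> cylinder"
  unfolding cylinder_def by blast

lemma cylinder_L2: "(\<lambda>\<omega>. w (past n \<omega>)) \<in> L2 \<Omega>"
proof (rule L2_bounded)
  show "(\<lambda>\<omega>. w (past n \<omega>)) \<in> borel_measurable \<Omega>"
    by (rule measurable_compose[OF past_measurable words_measurable])
  show "cmod (w (past n \<omega>)) \<le> Max ((\<lambda>b. cmod (w b)) ` words n)" if "\<omega> \<in> space \<Omega>" for \<omega>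
    using past_words[OF that] finite_words by (intro Max_ge) auto
qed

lemma norm_sq_cylinder:
  "L2_norm_sq \<Omega> (\<lambda>\<omega>. w (past n \<omega>)) = (\<Sum>b\<in>words n. (cmod (w b))\<^sup>2) / (\<Prod>k=1..n. real (card (B k)))"
proof -
  have "complex_of_real (L2_norm_sq \<Omega> (\<lambda>\<omega>. w (past n \<omega>)))
      = (\<integral>\<omega>. of_real ((cmod (w (past n \<omega>)))\<^sup>2) \<partial>\<Omega>)"
    unfolding L2_norm_sq_def by (rule integral_complex_of_real[symmetric])
  also have "\<dots> = of_real ((\<Sum>b\<in>words n. (cmod (w b))\<^sup>2) / (\<Prod>k=1..n. real (card (B k))))"
    using expectation_past(2)[of "\<lambda>b. of_real ((cmod (w b))\<^sup>2)" n] by simp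
  finally show ?thesis by (simp only: of_real_eq_iff)
qed

lemma cylinder_extend: "m \<le> n \<Longrightarrow> past m (past n \<omega>) = past m \<omega>"
  by (simp add: restrict_restrict Int_absorb1)

sublocale L2_generating \<Omega> cylinder "prod_algebra {1..} U"
proof
  show "cylinder \<subseteq> L2 \<Omega>" using cylinder_L2 unfolding cylinder_def by blast
  show "(\<lambda>\<omega>. f \<omega> + g \<omega>) \<in> cylinder" if fg: "f \<in> cylinder" "g \<in> cylinder" for f g
  proof -
    obtain n w m v where "f = (\<lambda>\<omega>. w (past n \<omega>))" "g = (\<lambda>\<omega>. v (past m \<omega>))"
      using fg by (auto simp: cylinder_def)
    then show ?thesis
      using cylinderI[of "\<lambda>b. w (past n b) + v (past m b)" "max n m"] by (simp add: cylinder_extend)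
  qed
  show "(\<lambda>\<omega>. c * f \<omega>) \<in> cylinder" if f: "f \<in> cylinder" for c f
  proof -
    obtain n w where "f = (\<lambda>\<omega>. w (past n \<omega>))" using f by (auto simp: cylinder_def)
    then show ?thesis using cylinderI[of "\<lambda>b. c * w b" n] by simp
  qed
  show "(\<lambda>\<omega>. 1) \<in> cylinder" by (rule cylinderI[of "\<lambda>_. 1" 0])
  show "\<exists>f\<in>cylinder. \<forall>\<omega>\<in>space \<Omega>. indicator A \<omega> = f \<omega>" if A: "A \<in> prod_algebra {1..} U" for A
  proof -
    from A obtain J E where JE: "A = prod_emb {1..} U J (\<Pi>\<^sub>E j\<in>J. E j)" "finite J" "J \<subseteq> {1..}"
      by (elim prod_algebraE) auto
    \<comment> \<open>A generator set constrains only the finitely many coordinates in J. Once J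
      lies within the first N indices, its indicator is a function of the past of length N.\<close>
    obtain N where N: "J \<subseteq> {1..N}"
      using \<open>finite J\<close> \<open>J \<subseteq> {1..}\<close> by (meson atLeastAtMost_iff atLeast_iff finite_nat_set_iff_bounded_le subset_iff)
    have mem: "\<omega> \<in> A \<longleftrightarrow> restrict \<omega> J \<in> (\<Pi>\<^sub>E j\<in>J. E j)" if "\<omega> \<in> space \<Omega>" for \<omega>
      using that by (simp add: JE(1) prod_emb_def digit_space_def space_PiM)
    have "restrict (past N \<omega>) J = restrict \<omega> J" for \<omega> :: "nat \<Rightarrow> int ^ 'n"
      using N by (simp add: restrict_restrict Int_absorb1)
    then have "\<forall>\<omega>\<in>space \<Omega>. indicator A \<omega>
        = (if restrict (past N \<omega>) J \<in> (\<Pi>\<^sub>E j\<in>J. E j) then 1 else 0 :: complex)"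
      using mem by (simp add: indicator_def)
    then show ?thesis
      using cylinderI[of "\<lambda>b. if restrict b J \<in> (\<Pi>\<^sub>E j\<in>J. E j) then 1 else 0" N] by (rule bexI)
  qed
  show "sets \<Omega> = sigma_sets (space \<Omega>) (prod_algebra {1..} U)"
    by (simp add: digit_space_def sets_PiM space_PiM)
  show "Int_stable (prod_algebra {1..} U)" by (rule Int_stable_prod_algebra)
  show "prod_algebra {1..} U \<subseteq> Pow (space \<Omega>)"
    using prod_algebra_sets_into_space[of "{1..}" U] by (simp add: digit_space_def space_PiM)
qed

end

section \<open>Frame and Riesz bounds\<close>

lemma Lambda_n_Suc:
  assumes "0 \<in> L (Suc n)"
  shows "Lambda_n R L n \<subseteq> Lambda_n R L (Suc n)"
proof
  fix \<xi> assume "\<xi> \<in> Lambda_n R L n"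
  then obtain l where l: "l \<in> (\<Pi>\<^sub>E k\<in>{1..n}. L k)" "\<xi> = freq_sum R n l" by (auto simp: Lambda_n_def)
  have "l(Suc n := 0) \<in> (\<Pi>\<^sub>E k\<in>{1..Suc n}. L k)"
    using l(1) assms by (auto simp: PiE_iff extensional_def)
  moreover have "\<xi> = freq_sum R (Suc n) (l(Suc n := 0))" by (simp add: freq_sum_Suc l(2))
  ultimately show "\<xi> \<in> Lambda_n R L (Suc n)" unfolding Lambda_n_def by blast
qed

lemma Lambda_n_mono:
  assumes "\<forall>k>m. 0 \<in> L k" "m \<le> n"
  shows "Lambda_n R L m \<subseteq> Lambda_n R L n"
  using \<open>m \<le> n\<close>
proof (induction rule: dec_induct)
  case (step n)
  then show ?case using Lambda_n_Suc[of L n R] assms(1) by auto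
qed simp

text \<open>The levels increase, since the frequency 0 can always be appended. The free lower bound
  m lets the same level also accommodate a given cylinder function.\<close>

lemma finite_subset_Lambda:
  assumes "\<forall>k\<ge>1. 0 \<in> L k" "finite F" "F \<subseteq> Lambda R L"
  shows "\<exists>n\<ge>1. n \<ge> m \<and> F \<subseteq> Lambda_n R L n"
  using assms(2,3)
proof (induction F rule: finite_induct)
  case empty
  then show ?case by (intro exI[of _ "max 1 m"]) auto
next
  case (insert \<xi> F)
  then obtain n where n: "n \<ge> 1" "n \<ge> m" "F \<subseteq> Lambda_n R L n" by auto
  obtain n' where n': "n' \<ge> 1" "\<xi> \<in> Lambda_n R L n'" using insert.prems by (auto simp: Lambda_def)
  show ?case
    using n n' Lambda_n_mono[of n L "max n n'" R] Lambda_n_mono[of n' L "max n n'" R] assms(1)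
    by (intro exI[of _ "max n n'"]) (auto simp del: One_nat_def)
qed

lemma L2_distr:
  assumes X: "X \<in> measurable M N" and f: "f \<in> L2 (distr M N X)"
  shows "(\<lambda>\<omega>. f (X \<omega>)) \<in> L2 M"
    and "L2_norm_sq (distr M N X) f = L2_norm_sq M (\<lambda>\<omega>. f (X \<omega>))"
    and "g \<in> borel_measurable N \<Longrightarrow>
          L2_inner (distr M N X) f g = L2_inner M (\<lambda>\<omega>. f (X \<omega>)) (\<lambda>\<omega>. g (X \<omega>))"
proof -
  have fm [measurable]: "f \<in> borel_measurable N" using f by (simp add: L2_def)
  note X [measurable]
  show "(\<lambda>\<omega>. f (X \<omega>)) \<in> L2 M" using f X by (simp add: L2_def integrable_distr_eq)
  show "L2_norm_sq (distr M N X) f = L2_norm_sq M (\<lambda>\<omega>. f (X \<omega>))"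
    unfolding L2_norm_sq_def by (rule integral_distr[OF X]) measurable
  show "L2_inner (distr M N X) f g = L2_inner M (\<lambda>\<omega>. f (X \<omega>)) (\<lambda>\<omega>. g (X \<omega>))"
    if [measurable]: "g \<in> borel_measurable N"
    unfolding L2_inner_def by (rule integral_distr[OF X]) measurable
qed

text \<open>For approximation arguments in which the factor c of the error may be large but does not
  change with \<epsilon>.\<close>

lemma le_of_small_error:
  fixes a b c :: real
  assumes "c \<ge> 0" "\<And>\<epsilon>. \<epsilon> > 0 \<Longrightarrow> a \<le> b + c * \<epsilon>"
  shows "a \<le> b"
proof (rule field_le_epsilon)
  fix \<epsilon> :: real assume "\<epsilon> > 0"
  then have "\<epsilon> / (c + 1) > 0" using \<open>c \<ge> 0\<close> by simp
  then have "a \<le> b + c * (\<epsilon> / (c + 1))" by (rule assms(2))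
  also have "c * (\<epsilon> / (c + 1)) \<le> \<epsilon>" using \<open>\<epsilon> > 0\<close> \<open>c \<ge> 0\<close> by (simp add: field_simps)
  finally show "a \<le> b + \<epsilon>" by simp
qed

declare One_nat_def [simp del]

text \<open>The lower data L, C and \<alpha> are parameters so that the results apply both to the
  given tower and to the tower with one frequency deleted; \<kappa> and \<delta> can then stay the
  same.\<close>

locale frame_system = digit_system R B for R :: "nat \<Rightarrow> int ^ 'n::finite ^ 'n" and B +
  fixes L :: "nat \<Rightarrow> (int ^ 'n) set" and C D :: "nat \<Rightarrow> real" and \<alpha> \<kappa> \<delta> :: real
  assumes fin_L: "\<forall>k\<ge>1. finite (L k)" and zero_L: "\<forall>k\<ge>1. 0 \<in> L k"
    and CD_nonneg: "\<forall>k\<ge>1. 0 \<le> C k \<and> 0 \<le> D k"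
    and lower: "\<And>k x. k \<ge> 1 \<Longrightarrow> C k * (\<Sum>b\<in>B k. (cmod (x b))\<^sup>2)
          \<le> (\<Sum>l\<in>L k. (cmod (\<Sum>b\<in>B k. x b * cnj (triple_vec (R k) (B k) l b)))\<^sup>2)"
    and upper: "\<And>k x. k \<ge> 1 \<Longrightarrow>
        (\<Sum>l\<in>L k. (cmod (\<Sum>b\<in>B k. x b * cnj (triple_vec (R k) (B k) l b)))\<^sup>2)
          \<le> D k * (\<Sum>b\<in>B k. (cmod (x b))\<^sup>2)"
    and \<alpha>: "0 < \<alpha>" "\<And>n. \<alpha> \<le> (\<Prod>k=1..n. C k)"
    and \<kappa>: "0 < \<kappa>" "\<And>n. (\<Prod>k=1..n. D k) \<le> \<kappa>"
    and \<delta>: "0 < \<delta>" "\<And>n \<xi>. n \<ge> 1 \<Longrightarrow> \<xi> \<in> Lambda_n R L n \<Longrightarrow> \<delta> \<le> (cmod (fourier (tower_tail R B n) (rvec \<xi>)))\<^sup>2"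
begin

abbreviation tuples :: "nat \<Rightarrow> (nat \<Rightarrow> int ^ 'n) set" where "tuples n \<equiv> \<Pi>\<^sub>E k\<in>{1..n}. L k"

definition N :: "nat \<Rightarrow> real" where "N n = (\<Prod>k=1..n. real (card (B k)))"

definition S :: "nat \<Rightarrow> ((nat \<Rightarrow> int ^ 'n) \<Rightarrow> complex) \<Rightarrow> int ^ 'n \<Rightarrow> complex"
  where "S n w \<xi> = (\<Sum>b\<in>words n. w b * cnj (expo \<xi> (digit_sum R n b)))"

abbreviation e :: "int ^ 'n \<Rightarrow> (nat \<Rightarrow> int ^ 'n) \<Rightarrow> complex"
  where "e \<xi> \<equiv> (\<lambda>\<omega>. expo \<xi> (tail_sum 0 \<omega>))"

lemma N_pos: "0 < N n"
proof -
  have "B k \<noteq> {}" for k using zero by blast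
  then show ?thesis using fin by (auto simp: N_def card_gt_0_iff intro!: prod_pos)
qed

lemma finite_tuples: "finite (tuples n)"
  using fin_L by (intro finite_PiE) auto

lemma finite_Lambda_n: "finite (Lambda_n R L n)"
  unfolding Lambda_n_def using finite_tuples by (rule finite_imageI)

lemma tuple_bounds:
  "\<alpha> * N n * (\<Sum>b\<in>words n. (cmod (w b))\<^sup>2) \<le> (\<Sum>l\<in>tuples n. (cmod (S n w (freq_sum R n l)))\<^sup>2)"
  "(\<Sum>l\<in>tuples n. (cmod (S n w (freq_sum R n l)))\<^sup>2) \<le> \<kappa> * N n * (\<Sum>b\<in>words n. (cmod (w b))\<^sup>2)"
proof -
  have W: "0 \<le> (\<Sum>b\<in>words n. (cmod (w b))\<^sup>2)" by (intro sum_nonneg) auto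
  have fB: "\<forall>k\<ge>1. finite (B k)" and nB: "\<forall>k\<ge>1. B k \<noteq> {}" using fin zero by auto
  note bounds = tower_product_bounds[OF inv fB nB fin_L CD_nonneg lower upper, of n w, folded N_def S_def]
  have "\<alpha> * N n * (\<Sum>b\<in>words n. (cmod (w b))\<^sup>2) \<le> (\<Prod>k=1..n. C k) * N n * (\<Sum>b\<in>words n. (cmod (w b))\<^sup>2)"
    using \<alpha>(2)[of n] N_pos[of n] W by (intro mult_right_mono) auto
  also note bounds[THEN conjunct1]
  finally show "\<alpha> * N n * (\<Sum>b\<in>words n. (cmod (w b))\<^sup>2) \<le> (\<Sum>l\<in>tuples n. (cmod (S n w (freq_sum R n l)))\<^sup>2)" .
  note bounds[THEN conjunct2]
  also have "(\<Prod>k=1..n. D k) * N n * (\<Sum>b\<in>words n. (cmod (w b))\<^sup>2) \<le> \<kappa> * N n * (\<Sum>b\<in>words n. (cmod (w b))\<^sup>2)"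
    using \<kappa>(2)[of n] N_pos[of n] W by (intro mult_right_mono) auto
  finally show "(\<Sum>l\<in>tuples n. (cmod (S n w (freq_sum R n l)))\<^sup>2) \<le> \<kappa> * N n * (\<Sum>b\<in>words n. (cmod (w b))\<^sup>2)" .
qed

lemma card_words: "real (card (words n)) = N n"
  by (simp add: N_def card_PiE)

text \<open>A frequency hit by \<open>m\<close> tuples contributes \<open>m\<close> copies of one unit vector to the product
  frame, so the upper frame bound also bounds all multiplicities. This is what makes the passage from
  tuples to the set of frequencies harmless.\<close>

lemma freq_multiplicity_le: "real (card {l \<in> tuples n. freq_sum R n l = \<xi>}) \<le> \<kappa>"
proof -
  define w where "w = (\<lambda>b. expo \<xi> (digit_sum R n b))"
  have "S n w \<xi> = of_nat (card (words n))"
    by (simp add: S_def w_def complex_norm_square[symmetric])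
  then have Sw: "(cmod (S n w \<xi>))\<^sup>2 = (N n)\<^sup>2" by (simp flip: card_words)
  have "real (card {l \<in> tuples n. freq_sum R n l = \<xi>}) * (N n)\<^sup>2
      = (\<Sum>l | l \<in> tuples n \<and> freq_sum R n l = \<xi>. (cmod (S n w (freq_sum R n l)))\<^sup>2)"
    by (simp add: Sw)
  also have "\<dots> \<le> (\<Sum>l\<in>tuples n. (cmod (S n w (freq_sum R n l)))\<^sup>2)"
    using finite_tuples by (intro sum_mono2) auto
  also have "\<dots> \<le> \<kappa> * N n * (\<Sum>b\<in>words n. (cmod (w b))\<^sup>2)" by (rule tuple_bounds)
  also have "\<dots> = \<kappa> * (N n)\<^sup>2" by (simp add: w_def card_words power2_eq_square)
  finally show ?thesis using N_pos[of n] by simp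
qed

lemma sum_Lambda_n:
  fixes g :: "int ^ 'n \<Rightarrow> real"
  assumes "\<And>\<xi>. 0 \<le> g \<xi>"
  shows "(\<Sum>\<xi>\<in>Lambda_n R L n. g \<xi>) \<le> (\<Sum>l\<in>tuples n. g (freq_sum R n l))"
    and "(\<Sum>l\<in>tuples n. g (freq_sum R n l)) \<le> \<kappa> * (\<Sum>\<xi>\<in>Lambda_n R L n. g \<xi>)"
proof -
  show "(\<Sum>\<xi>\<in>Lambda_n R L n. g \<xi>) \<le> (\<Sum>l\<in>tuples n. g (freq_sum R n l))"
    unfolding Lambda_n_def using sum_image_le[OF finite_tuples, of n g] assms by (simp add: comp_def)
  have "(\<Sum>l\<in>tuples n. g (freq_sum R n l))
      = (\<Sum>\<xi>\<in>Lambda_n R L n. \<Sum>l | l \<in> tuples n \<and> freq_sum R n l = \<xi>. g (freq_sum R n l))"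
    unfolding Lambda_n_def by (rule sum.image_gen[OF finite_tuples])
  also have "\<dots> = (\<Sum>\<xi>\<in>Lambda_n R L n. real (card {l \<in> tuples n. freq_sum R n l = \<xi>}) * g \<xi>)"
    by (intro sum.cong) auto
  also have "\<dots> \<le> (\<Sum>\<xi>\<in>Lambda_n R L n. \<kappa> * g \<xi>)"
    by (intro sum_mono mult_right_mono freq_multiplicity_le assms)
  finally show "(\<Sum>l\<in>tuples n. g (freq_sum R n l)) \<le> \<kappa> * (\<Sum>\<xi>\<in>Lambda_n R L n. g \<xi>)"
    by (simp add: sum_distrib_left)
qed

lemma e_measurable: "e \<xi> \<in> borel_measurable \<Omega>"
  unfolding digit_space_def by (rule measurable_compose[OF tail_sum_measurable expo_measurable]) auto

lemma e_L2: "e \<xi> \<in> L2 \<Omega>"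
  using e_measurable by (intro L2_bounded[of _ 1]) auto

lemma cmod_inner_cylinder:
  "(cmod (L2_inner \<Omega> (\<lambda>\<omega>. w (past n \<omega>)) (e \<xi>)))\<^sup>2
    = (cmod (S n w \<xi>))\<^sup>2 / (N n)\<^sup>2 * (cmod (fourier (tower_tail R B n) (rvec \<xi>)))\<^sup>2"
proof -
  have "(\<Prod>k=1..n. complex_of_nat (card (B k))) = of_real (N n)" by (simp add: N_def)
  then show ?thesis
    by (simp add: inner_cylinder_expo S_def[symmetric] norm_mult norm_divide power_mult_distrib
        power_divide del: One_nat_def)
qed

text \<open>The loss \<delta> comes from the Fourier transform of the tail, the loss 1 / \<kappa>
  from replacing tuples by the set of frequencies. The upper bound loses neither, because the tail
  transform is at most 1 in modulus and every frequency comes from at least one tuple.\<close>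

lemma cylinder_bounds:
  assumes "n \<ge> 1"
  shows "\<delta> * \<alpha> / \<kappa> * L2_norm_sq \<Omega> (\<lambda>\<omega>. w (past n \<omega>))
      \<le> (\<Sum>\<xi>\<in>Lambda_n R L n. (cmod (L2_inner \<Omega> (\<lambda>\<omega>. w (past n \<omega>)) (e \<xi>)))\<^sup>2)"
    and "(\<Sum>\<xi>\<in>Lambda_n R L n. (cmod (L2_inner \<Omega> (\<lambda>\<omega>. w (past n \<omega>)) (e \<xi>)))\<^sup>2)
      \<le> \<kappa> * L2_norm_sq \<Omega> (\<lambda>\<omega>. w (past n \<omega>))"
proof -
  define W where "W = (\<Sum>b\<in>words n. (cmod (w b))\<^sup>2)"
  define T where "T = (\<Sum>\<xi>\<in>Lambda_n R L n. (cmod (S n w \<xi>))\<^sup>2)"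
  have nW: "L2_norm_sq \<Omega> (\<lambda>\<omega>. w (past n \<omega>)) = W / N n"
    by (simp add: norm_sq_cylinder W_def N_def)
  have T: "\<alpha> * N n * W \<le> \<kappa> * T" "T \<le> \<kappa> * N n * W"
    using order_trans[OF tuple_bounds(1) sum_Lambda_n(2)] order_trans[OF sum_Lambda_n(1) tuple_bounds(2)]
    unfolding T_def W_def by auto
  have "\<delta> * \<alpha> / \<kappa> * (W / N n) = \<delta> / (N n)\<^sup>2 * (\<alpha> * N n * W / \<kappa>)"
    using N_pos[of n] by (simp add: field_simps power2_eq_square)
  also have "\<dots> \<le> \<delta> / (N n)\<^sup>2 * T"
    using T(1) \<kappa>(1) \<delta>(1) by (intro mult_left_mono) (auto simp: field_simps)
  also have "\<dots> = (\<Sum>\<xi>\<in>Lambda_n R L n. (cmod (S n w \<xi>))\<^sup>2 / (N n)\<^sup>2 * \<delta>)"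
    by (simp add: T_def sum_distrib_left mult.commute)
  also have "\<dots> \<le> (\<Sum>\<xi>\<in>Lambda_n R L n. (cmod (L2_inner \<Omega> (\<lambda>\<omega>. w (past n \<omega>)) (e \<xi>)))\<^sup>2)"
    unfolding cmod_inner_cylinder using \<delta>(2)[OF assms] by (intro sum_mono mult_left_mono) auto
  finally show "\<delta> * \<alpha> / \<kappa> * L2_norm_sq \<Omega> (\<lambda>\<omega>. w (past n \<omega>)) \<le> \<dots>" unfolding nW .
  have "(\<Sum>\<xi>\<in>Lambda_n R L n. (cmod (L2_inner \<Omega> (\<lambda>\<omega>. w (past n \<omega>)) (e \<xi>)))\<^sup>2)
      \<le> (\<Sum>\<xi>\<in>Lambda_n R L n. (cmod (S n w \<xi>))\<^sup>2 / (N n)\<^sup>2 * 1)"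
    unfolding cmod_inner_cylinder using fourier_tower_tail_le
    by (intro sum_mono mult_left_mono power_le_one) auto
  also have "\<dots> = T / (N n)\<^sup>2" by (simp add: T_def sum_divide_distrib)
  also have "\<dots> \<le> \<kappa> * N n * W / (N n)\<^sup>2" using T(2) by (intro divide_right_mono) auto
  also have "\<dots> = \<kappa> * (W / N n)" using N_pos[of n] by (simp add: power2_eq_square)
  finally show "(\<Sum>\<xi>\<in>Lambda_n R L n. (cmod (L2_inner \<Omega> (\<lambda>\<omega>. w (past n \<omega>)) (e \<xi>)))\<^sup>2)
      \<le> \<kappa> * L2_norm_sq \<Omega> (\<lambda>\<omega>. w (past n \<omega>))" unfolding nW .
qed

text \<open>A function of m digits is also one of n \<ge> m digits, so the digit level can be raised
  to match the frequency level.\<close>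

lemma cylinder_level:
  assumes "g \<in> cylinder"
  obtains m where "\<And>n. n \<ge> m \<Longrightarrow> \<exists>w. g = (\<lambda>\<omega>. w (past n \<omega>))"
proof -
  obtain m w where g: "g = (\<lambda>\<omega>. w (past m \<omega>))" using assms by (auto simp: cylinder_def)
  show ?thesis
  proof (rule that[of m])
    fix n assume "n \<ge> m"
    then show "\<exists>w. g = (\<lambda>\<omega>. w (past n \<omega>))"
      unfolding g by (intro exI[of _ "\<lambda>b. w (past m b)"]) (simp add: cylinder_extend)
  qed
qed

lemma approx:
  assumes "f \<in> L2 \<Omega>" "\<epsilon> > 0"
  obtains g where "g \<in> cylinder" "L2_norm_sq \<Omega> (\<lambda>\<omega>. f \<omega> - g \<omega>) < \<epsilon>"
  using assms L2_closureE closure_eq_L2 by metis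

lemma sum_inner_add_le:
  assumes "f \<in> L2 \<Omega>" "g \<in> L2 \<Omega>"
  shows "(\<Sum>\<xi>\<in>F. (cmod (L2_inner \<Omega> f (e \<xi>)))\<^sup>2)
    \<le> 2 * (\<Sum>\<xi>\<in>F. (cmod (L2_inner \<Omega> g (e \<xi>)))\<^sup>2) + 2 * (\<Sum>\<xi>\<in>F. (cmod (L2_inner \<Omega> (\<lambda>\<omega>. f \<omega> - g \<omega>) (e \<xi>)))\<^sup>2)"
proof -
  have "L2_inner \<Omega> f (e \<xi>) = L2_inner \<Omega> g (e \<xi>) + L2_inner \<Omega> (\<lambda>\<omega>. f \<omega> - g \<omega>) (e \<xi>)" for \<xi>
    using L2_inner_diff_left[OF assms e_L2] by simp
  then have le: "(cmod (L2_inner \<Omega> f (e \<xi>)))\<^sup>2 \<le> 2 * (cmod (L2_inner \<Omega> g (e \<xi>)))\<^sup>2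
      + 2 * (cmod (L2_inner \<Omega> (\<lambda>\<omega>. f \<omega> - g \<omega>) (e \<xi>)))\<^sup>2" for \<xi>
    by (simp only: cmod_add_sq_le)
  have "(\<Sum>\<xi>\<in>F. (cmod (L2_inner \<Omega> f (e \<xi>)))\<^sup>2) \<le> (\<Sum>\<xi>\<in>F. 2 * (cmod (L2_inner \<Omega> g (e \<xi>)))\<^sup>2
      + 2 * (cmod (L2_inner \<Omega> (\<lambda>\<omega>. f \<omega> - g \<omega>) (e \<xi>)))\<^sup>2)"
    by (rule sum_mono) (rule le)
  then show ?thesis by (simp only: sum.distrib sum_distrib_left)
qed

lemma norm_sq_approx_le:
  assumes "f \<in> L2 \<Omega>" "g \<in> L2 \<Omega>"
  shows "L2_norm_sq \<Omega> f \<le> 2 * L2_norm_sq \<Omega> g + 2 * L2_norm_sq \<Omega> (\<lambda>\<omega>. f \<omega> - g \<omega>)"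
  using L2_norm_sq_add_le[OF assms(2) L2_diff[OF assms]] by simp

text \<open>The approximation error is bounded crudely, frequency by frequency, at the cost of
  \<open>card F\<close>. This is harmless because F is fixed while \<epsilon> tends to 0, and the
  resulting bound no longer depends on F.\<close>

lemma bessel:
  assumes f: "f \<in> L2 \<Omega>" and F: "finite F" "F \<subseteq> Lambda R L"
  shows "(\<Sum>\<xi>\<in>F. (cmod (L2_inner \<Omega> f (e \<xi>)))\<^sup>2) \<le> 4 * \<kappa> * L2_norm_sq \<Omega> f"
proof (rule le_of_small_error)
  show "4 * \<kappa> + 2 * real (card F) \<ge> 0" using \<kappa>(1) by simp
  fix \<epsilon> :: real assume "\<epsilon> > 0"
  then obtain g where g: "g \<in> cylinder" "L2_norm_sq \<Omega> (\<lambda>\<omega>. f \<omega> - g \<omega>) < \<epsilon>" using approx[OF f] by blast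
  have gL: "g \<in> L2 \<Omega>" using g(1) V_L2 by auto
  let ?E = "L2_norm_sq \<Omega> (\<lambda>\<omega>. f \<omega> - g \<omega>)"
  obtain m where m: "\<And>n. n \<ge> m \<Longrightarrow> \<exists>w. g = (\<lambda>\<omega>. w (past n \<omega>))" by (rule cylinder_level[OF g(1)]) blast
  obtain n where n: "n \<ge> 1" "n \<ge> m" "F \<subseteq> Lambda_n R L n" using finite_subset_Lambda[OF zero_L F] by blast
  obtain w where w: "g = (\<lambda>\<omega>. w (past n \<omega>))" using m[OF n(2)] by blast
  have "(\<Sum>\<xi>\<in>F. (cmod (L2_inner \<Omega> g (e \<xi>)))\<^sup>2) \<le> (\<Sum>\<xi>\<in>Lambda_n R L n. (cmod (L2_inner \<Omega> g (e \<xi>)))\<^sup>2)"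
    using n(3) finite_Lambda_n by (intro sum_mono2) auto
  also have "\<dots> \<le> \<kappa> * L2_norm_sq \<Omega> g" unfolding w by (rule cylinder_bounds(2)[OF n(1)])
  finally have 1: "(\<Sum>\<xi>\<in>F. (cmod (L2_inner \<Omega> g (e \<xi>)))\<^sup>2) \<le> \<kappa> * L2_norm_sq \<Omega> g" .
  have "(\<Sum>\<xi>\<in>F. (cmod (L2_inner \<Omega> (\<lambda>\<omega>. f \<omega> - g \<omega>) (e \<xi>)))\<^sup>2) \<le> (\<Sum>\<xi>\<in>F. ?E)"
    using f gL e_measurable by (intro sum_mono L2_inner_unimodular_le L2_diff) auto
  then have 2: "(\<Sum>\<xi>\<in>F. (cmod (L2_inner \<Omega> (\<lambda>\<omega>. f \<omega> - g \<omega>) (e \<xi>)))\<^sup>2) \<le> real (card F) * ?E" by simp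
  have 3: "L2_norm_sq \<Omega> g \<le> 2 * L2_norm_sq \<Omega> f + 2 * ?E"
    using norm_sq_approx_le[OF gL f] unfolding L2_norm_sq_diff_commute[of \<Omega> g f] .
  have "(\<Sum>\<xi>\<in>F. (cmod (L2_inner \<Omega> f (e \<xi>)))\<^sup>2) \<le> 2 * (\<kappa> * L2_norm_sq \<Omega> g) + 2 * (real (card F) * ?E)"
    using sum_inner_add_le[OF f gL, of F] 1 2 by linarith
  also have "\<dots> \<le> 2 * (\<kappa> * (2 * L2_norm_sq \<Omega> f + 2 * ?E)) + 2 * (real (card F) * ?E)"
    using 3 \<kappa>(1) by simp
  also have "\<dots> = 4 * \<kappa> * L2_norm_sq \<Omega> f + (4 * \<kappa> + 2 * real (card F)) * ?E" by (simp add: algebra_simps)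
  also have "\<dots> \<le> 4 * \<kappa> * L2_norm_sq \<Omega> f + (4 * \<kappa> + 2 * real (card F)) * \<epsilon>"
    using g(2) \<kappa>(1) by (intro add_left_mono mult_left_mono) auto
  finally show "(\<Sum>\<xi>\<in>F. (cmod (L2_inner \<Omega> f (e \<xi>)))\<^sup>2) \<le> \<dots>" .
qed

text \<open>Here the level n is dictated by the approximant, so a cost proportional to the number of
  frequencies would not vanish with \<epsilon>. The error is controlled by the uniform bound
  \<open>bessel\<close> instead. The bound s stands in for the infinite sum.\<close>

lemma frame_lower:
  assumes f: "f \<in> L2 \<Omega>" and s: "\<And>n. n \<ge> 1 \<Longrightarrow> (\<Sum>\<xi>\<in>Lambda_n R L n. (cmod (L2_inner \<Omega> f (e \<xi>)))\<^sup>2) \<le> s"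
  shows "\<delta> * \<alpha> / \<kappa> * L2_norm_sq \<Omega> f \<le> 4 * s"
proof (rule le_of_small_error)
  define A where "A = \<delta> * \<alpha> / \<kappa>"
  have A: "A > 0" using \<delta>(1) \<alpha>(1) \<kappa>(1) by (simp add: A_def)
  show "16 * \<kappa> + 2 * A \<ge> 0" using \<kappa>(1) A by simp
  fix \<epsilon> :: real assume "\<epsilon> > 0"
  then obtain g where g: "g \<in> cylinder" "L2_norm_sq \<Omega> (\<lambda>\<omega>. f \<omega> - g \<omega>) < \<epsilon>" using approx[OF f] by blast
  have gL: "g \<in> L2 \<Omega>" using g(1) V_L2 by auto
  let ?E = "L2_norm_sq \<Omega> (\<lambda>\<omega>. f \<omega> - g \<omega>)"
  obtain m where m: "\<And>n. n \<ge> m \<Longrightarrow> \<exists>w. g = (\<lambda>\<omega>. w (past n \<omega>))" by (rule cylinder_level[OF g(1)]) blast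
  define n where "n = max 1 m"
  have n: "n \<ge> 1" "n \<ge> m" by (auto simp: n_def)
  obtain w where w: "g = (\<lambda>\<omega>. w (past n \<omega>))" using m[OF n(2)] by blast
  have "A * L2_norm_sq \<Omega> g \<le> (\<Sum>\<xi>\<in>Lambda_n R L n. (cmod (L2_inner \<Omega> g (e \<xi>)))\<^sup>2)"
    unfolding w A_def by (rule cylinder_bounds(1)[OF n(1)])
  also have "\<dots> \<le> 2 * (\<Sum>\<xi>\<in>Lambda_n R L n. (cmod (L2_inner \<Omega> f (e \<xi>)))\<^sup>2)
      + 2 * (\<Sum>\<xi>\<in>Lambda_n R L n. (cmod (L2_inner \<Omega> (\<lambda>\<omega>. g \<omega> - f \<omega>) (e \<xi>)))\<^sup>2)"
    by (rule sum_inner_add_le[OF gL f])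
  also have "\<dots> \<le> 2 * s + 2 * (4 * \<kappa> * L2_norm_sq \<Omega> (\<lambda>\<omega>. g \<omega> - f \<omega>))"
    using n(1) by (intro add_mono mult_left_mono s bessel L2_diff gL f finite_Lambda_n) (auto simp: Lambda_def)
  finally have 1: "A * L2_norm_sq \<Omega> g \<le> 2 * s + 8 * \<kappa> * ?E"
    unfolding L2_norm_sq_diff_commute[of \<Omega> g f] by simp
  have "A * L2_norm_sq \<Omega> f \<le> A * (2 * L2_norm_sq \<Omega> g + 2 * ?E)"
    using A norm_sq_approx_le[OF f gL] by (intro mult_left_mono) auto
  also have "\<dots> \<le> 4 * s + (16 * \<kappa> + 2 * A) * ?E" using 1 by (simp add: algebra_simps)
  also have "\<dots> \<le> 4 * s + (16 * \<kappa> + 2 * A) * \<epsilon>"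
    using g(2) \<kappa>(1) A by (intro add_left_mono mult_left_mono) auto
  finally show "\<delta> * \<alpha> / \<kappa> * L2_norm_sq \<Omega> f \<le> 4 * s + (16 * \<kappa> + 2 * A) * \<epsilon>" unfolding A_def .
qed

section \<open>Transfer to the measure and the frame property\<close>

lemma tower_measure_eq: "tower_measure R B = distr \<Omega> borel (tail_sum 0)"
  unfolding tower_measure_def by (rule tower_tail_eq)

lemma tail_sum_0_measurable: "tail_sum 0 \<in> borel_measurable \<Omega>"
  unfolding digit_space_def by (rule tail_sum_measurable) auto

lemmas pullback = L2_distr[OF tail_sum_0_measurable, folded tower_measure_eq]

lemma expo_L2: "expo \<xi> \<in> L2 (tower_measure R B)"
proof -
  interpret M: prob_space "tower_measure R B"
    unfolding tower_measure_eq by (rule prob_space_distr[OF tail_sum_0_measurable])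
  show ?thesis
    by (rule M.L2_bounded[of _ 1]) (use expo_measurable in \<open>auto simp: tower_measure_eq\<close>)
qed

lemma frame: "L2_frame (tower_measure R B) (Lambda R L) expo"
  unfolding L2_frame_def
proof (intro conjI ballI expo_L2)
  let ?M = "tower_measure R B"
  have main: "(\<lambda>k. (cmod (L2_inner ?M f (expo k)))\<^sup>2) summable_on Lambda R L \<and>
      \<delta> * \<alpha> / (4 * \<kappa>) * L2_norm_sq ?M f \<le> (\<Sum>\<^sub>\<infinity>k\<in>Lambda R L. (cmod (L2_inner ?M f (expo k)))\<^sup>2) \<and>
      (\<Sum>\<^sub>\<infinity>k\<in>Lambda R L. (cmod (L2_inner ?M f (expo k)))\<^sup>2) \<le> 4 * \<kappa> * L2_norm_sq ?M f"
    if f: "f \<in> L2 ?M" for f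
  proof -
    define h where "h = (\<lambda>\<omega>. f (tail_sum 0 \<omega>))"
    have h: "h \<in> L2 \<Omega>" "L2_norm_sq ?M f = L2_norm_sq \<Omega> h"
      "L2_inner ?M f (expo k) = L2_inner \<Omega> h (e k)" for k
      unfolding h_def using pullback[OF f] expo_measurable by auto
    let ?t = "\<lambda>k. (cmod (L2_inner \<Omega> h (e k)))\<^sup>2"
    have summ: "?t summable_on Lambda R L"
    proof (rule nonneg_bdd_above_summable_on)
      show "bdd_above (sum ?t ` {F. F \<subseteq> Lambda R L \<and> finite F})"
        by (intro bdd_aboveI2[of _ _ "4 * \<kappa> * L2_norm_sq \<Omega> h"]) (auto intro!: bessel h)
    qed simp
    have "(\<Sum>\<xi>\<in>Lambda_n R L n. ?t \<xi>) \<le> (\<Sum>\<^sub>\<infinity>k\<in>Lambda R L. ?t k)" if "n \<ge> 1" for n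
      using that by (intro finite_sum_le_infsum summ finite_Lambda_n) (auto simp: Lambda_def)
    from frame_lower[OF h(1) this] have "\<delta> * \<alpha> / (4 * \<kappa>) * L2_norm_sq \<Omega> h \<le> (\<Sum>\<^sub>\<infinity>k\<in>Lambda R L. ?t k)"
      using \<kappa>(1) by (simp add: field_simps)
    moreover have "(\<Sum>\<^sub>\<infinity>k\<in>Lambda R L. ?t k) \<le> 4 * \<kappa> * L2_norm_sq \<Omega> h"
      by (intro infsum_le_finite_sums summ bessel h)
    ultimately show ?thesis using summ unfolding h by blast
  qed
  show "\<exists>C>0. \<exists>D>0. \<forall>f\<in>L2 ?M. (\<lambda>k. (cmod (L2_inner ?M f (expo k)))\<^sup>2) summable_on Lambda R L \<and>
      C * L2_norm_sq ?M f \<le> (\<Sum>\<^sub>\<infinity>k\<in>Lambda R L. (cmod (L2_inner ?M f (expo k)))\<^sup>2) \<and>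
      (\<Sum>\<^sub>\<infinity>k\<in>Lambda R L. (cmod (L2_inner ?M f (expo k)))\<^sup>2) \<le> D * L2_norm_sq ?M f"
    using main \<delta>(1) \<alpha>(1) \<kappa>(1)
    by (intro exI[of _ "\<delta> * \<alpha> / (4 * \<kappa>)"] exI[of _ "4 * \<kappa>"] conjI ballI) auto
qed

text \<open>Duality: a Bessel bound for the inner products with the exponentials bounds their linear
  combinations with the same constant. The weight c = 4 * \<kappa> lets the Bessel inequality absorb
  half of the squared norm of f.\<close>

lemma riesz_upper:
  assumes F: "finite F" "F \<subseteq> Lambda R L"
  shows "L2_norm_sq \<Omega> (\<lambda>\<omega>. \<Sum>k\<in>F. a k * e k \<omega>) \<le> 4 * \<kappa> * (\<Sum>k\<in>F. (cmod (a k))\<^sup>2)"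
proof -
  define f where "f = (\<lambda>\<omega>. \<Sum>k\<in>F. a k * e k \<omega>)"
  have f: "f \<in> L2 \<Omega>" unfolding f_def by (intro L2_sum L2_cmult e_L2)
  define c where "c = 4 * \<kappa>"
  have c: "c > 0" using \<kappa>(1) by (simp add: c_def)
  define i where "i = (\<lambda>k. L2_inner \<Omega> f (e k))"
  have "complex_of_real (L2_norm_sq \<Omega> f) = L2_inner \<Omega> f (\<lambda>\<omega>. \<Sum>k\<in>F. a k * e k \<omega>)"
    unfolding L2_inner_self[symmetric] by (simp add: f_def)
  also have "\<dots> = (\<Sum>k\<in>F. cnj (a k) * i k)"
    by (simp add: L2_inner_sum_right[OF f L2_cmult[OF e_L2]] L2_inner_cmult_right i_def)
  finally have eq: "complex_of_real (L2_norm_sq \<Omega> f) = (\<Sum>k\<in>F. cnj (a k) * i k)" .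
  have "L2_norm_sq \<Omega> f \<le> cmod (complex_of_real (L2_norm_sq \<Omega> f))" by simp
  also have "\<dots> \<le> (\<Sum>k\<in>F. cmod (a k) * cmod (i k))"
    unfolding eq by (rule order_trans[OF norm_sum]) (simp add: norm_mult)
  also have "\<dots> \<le> (\<Sum>k\<in>F. (c * (cmod (a k))\<^sup>2 + (cmod (i k))\<^sup>2 / c) / 2)"
  proof (intro sum_mono)
    fix k
    have "0 \<le> (c * cmod (a k) - cmod (i k))\<^sup>2 / c" using c by simp
    then show "cmod (a k) * cmod (i k) \<le> (c * (cmod (a k))\<^sup>2 + (cmod (i k))\<^sup>2 / c) / 2"
      using c by (simp add: power2_diff power_mult_distrib field_simps power2_eq_square)
  qed
  also have "\<dots> = (c * (\<Sum>k\<in>F. (cmod (a k))\<^sup>2) + (\<Sum>k\<in>F. (cmod (i k))\<^sup>2) / c) / 2"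
    by (simp add: sum.distrib sum_distrib_left sum_divide_distrib[symmetric])
  also have "\<dots> \<le> (c * (\<Sum>k\<in>F. (cmod (a k))\<^sup>2) + L2_norm_sq \<Omega> f) / 2"
    using bessel[OF f F] c by (simp add: c_def i_def field_simps)
  finally show ?thesis by (simp add: c_def f_def)
qed

lemma riesz_lower:
  assumes card: "\<forall>k\<ge>1. card (B k) = card (L k)" and F: "finite F" "F \<subseteq> Lambda R L"
  shows "\<alpha> * \<delta> * (\<Sum>k\<in>F. (cmod (a k))\<^sup>2) \<le> L2_norm_sq \<Omega> (\<lambda>\<omega>. \<Sum>k\<in>F. a k * e k \<omega>)"
proof -
  obtain n where n: "n \<ge> 1" "F \<subseteq> Lambda_n R L n" using finite_subset_Lambda[OF zero_L F] by blast
  have cardn: "card (words n) = card (tuples n)" using card by (simp add: card_PiE)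
  define E where "E = (\<lambda>b l. cnj (expo (freq_sum R n l) (digit_sum R n b)))"
  have adj: "\<alpha> * N n * (\<Sum>l\<in>tuples n. (cmod (y l))\<^sup>2)
      \<le> (\<Sum>b\<in>words n. (cmod (\<Sum>l\<in>tuples n. y l * expo (freq_sum R n l) (digit_sum R n b)))\<^sup>2)" for y
    using square_system_adjoint_bound[OF finite_words finite_tuples cardn, of "\<alpha> * N n" E y]
      tuple_bounds(1)[of n] \<alpha>(1) N_pos[of n] by (simp add: E_def S_def)
  \<comment> \<open>Two tuples with the same frequency would give a nonzero coefficient vector, 1 at
    one and -1 at the other, that the adjoint annihilates. So in the square case tuples and
    frequencies correspond one to one.\<close>
  have inj: "inj_on (freq_sum R n) (tuples n)"
  proof (rule inj_onI, rule ccontr)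
    fix l l' assume l: "l \<in> tuples n" "l' \<in> tuples n" "freq_sum R n l = freq_sum R n l'" "l \<noteq> l'"
    define y where "y = (\<lambda>m. if m = l then 1 else if m = l' then -1 else (0 :: complex))"
    have red: "(\<Sum>m\<in>tuples n. h m) = (\<Sum>m\<in>{l, l'}. h m)"
      if "\<And>m. m \<notin> {l, l'} \<Longrightarrow> h m = 0" for h :: "_ \<Rightarrow> 'b::comm_monoid_add"
      using l finite_tuples that by (intro sum.mono_neutral_right) auto
    have "(\<Sum>m\<in>tuples n. (cmod (y m))\<^sup>2) = 2" using l by (subst red) (auto simp: y_def)
    moreover have "(\<Sum>m\<in>tuples n. y m * expo (freq_sum R n m) (digit_sum R n b)) = 0" for b
      using l by (subst red) (auto simp: y_def)
    ultimately have "\<alpha> * N n * 2 \<le> 0" using adj[of y] by simp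
    then show False using \<alpha>(1) N_pos[of n] by (simp add: mult_le_0_iff)
  qed
  define \<mu> where "\<mu> = (\<lambda>\<xi>. fourier (tower_tail R B n) (rvec \<xi>))"
  \<comment> \<open>Averaging the exponential of the tail over the future digits gives the conjugate
    of \<mu>, which is where these weights come from; \<open>y\<close> carries the weighted
    coefficients, extended by 0 to all tuples.\<close>
  define v where "v = (\<lambda>b. \<Sum>\<xi>\<in>F. a \<xi> * cnj (\<mu> \<xi>) * expo \<xi> (digit_sum R n b))"
  define y where "y = (\<lambda>l. let \<xi> = freq_sum R n l in if \<xi> \<in> F then a \<xi> * cnj (\<mu> \<xi>) else 0)"
  have reindex: "(\<Sum>l\<in>tuples n. h (freq_sum R n l)) = (\<Sum>\<xi>\<in>F. h \<xi>)"
    if "\<And>\<xi>. \<xi> \<notin> F \<Longrightarrow> h \<xi> = 0" for h :: "_ \<Rightarrow> 'b::comm_monoid_add"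
  proof -
    have "(\<Sum>l\<in>tuples n. h (freq_sum R n l)) = (\<Sum>\<xi>\<in>Lambda_n R L n. h \<xi>)"
      unfolding Lambda_n_def by (simp add: sum.reindex[OF inj])
    also have "\<dots> = (\<Sum>\<xi>\<in>F. h \<xi>)"
      using that n(2) finite_Lambda_n by (intro sum.mono_neutral_right) auto
    finally show ?thesis .
  qed
  have v: "(\<Sum>l\<in>tuples n. y l * expo (freq_sum R n l) (digit_sum R n b)) = v b" for b
    using reindex[of "\<lambda>\<xi>. (if \<xi> \<in> F then a \<xi> * cnj (\<mu> \<xi>) else 0) * expo \<xi> (digit_sum R n b)"]
    by (simp add: y_def v_def Let_def cong: sum.cong)
  have y: "(\<Sum>l\<in>tuples n. (cmod (y l))\<^sup>2) = (\<Sum>\<xi>\<in>F. (cmod (a \<xi>))\<^sup>2 * (cmod (\<mu> \<xi>))\<^sup>2)"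
    using reindex[of "\<lambda>\<xi>. (cmod (if \<xi> \<in> F then a \<xi> * cnj (\<mu> \<xi>) else 0))\<^sup>2"]
    by (simp add: y_def Let_def norm_mult power_mult_distrib cong: sum.cong)
  define f g where "f = (\<lambda>\<omega>. \<Sum>k\<in>F. a k * e k \<omega>)" and "g = (\<lambda>\<omega>. v (past n \<omega>))"
  have f: "f \<in> L2 \<Omega>" unfolding f_def by (intro L2_sum L2_cmult e_L2)
  have g: "g \<in> L2 \<Omega>" unfolding g_def by (rule cylinder_L2)
  have ng: "L2_norm_sq \<Omega> g = (\<Sum>b\<in>words n. (cmod (v b))\<^sup>2) / N n"
    by (simp add: g_def norm_sq_cylinder N_def)
  \<comment> \<open>\<open>g\<close> is the conditional expectation of \<open>f\<close> given the first \<open>n\<close> digits\<close>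
  have "L2_inner \<Omega> g f = (\<Sum>k\<in>F. cnj (a k) * L2_inner \<Omega> g (e k))"
    unfolding f_def by (simp add: L2_inner_sum_right[OF g L2_cmult[OF e_L2]] L2_inner_cmult_right)
  also have "\<dots> = (\<Sum>k\<in>F. cnj (a k) * (S n v k / of_real (N n) * \<mu> k))"
    unfolding g_def inner_cylinder_expo by (simp add: S_def N_def \<mu>_def)
  also have "\<dots> = (\<Sum>k\<in>F. \<Sum>b\<in>words n. v b * cnj (a k * cnj (\<mu> k) * expo k (digit_sum R n b))) / of_real (N n)"
    unfolding S_def by (simp add: sum_divide_distrib sum_distrib_left sum_distrib_right mult_ac)
  also have "(\<Sum>k\<in>F. \<Sum>b\<in>words n. v b * cnj (a k * cnj (\<mu> k) * expo k (digit_sum R n b)))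
      = (\<Sum>b\<in>words n. v b * cnj (v b))"
    by (subst sum.swap) (simp add: v_def sum_distrib_left)
  also have "\<dots> / of_real (N n) = of_real (L2_norm_sq \<Omega> g)"
    by (simp only: ng of_real_divide of_real_sum complex_norm_square)
  finally have "Re (L2_inner \<Omega> g f) = L2_norm_sq \<Omega> g" by simp
  \<comment> \<open>The identity makes \<open>g\<close> an orthogonal projection of
    \<open>f\<close>: the squared norm of g - f is the difference of the two squared norms.\<close>
  then have "L2_norm_sq \<Omega> g \<le> L2_norm_sq \<Omega> f"
    using L2_norm_sq_diff[OF g f] L2_norm_sq_nonneg[of \<Omega> "\<lambda>\<omega>. g \<omega> - f \<omega>"] by simp
  moreover have "\<alpha> * (\<Sum>\<xi>\<in>F. (cmod (a \<xi>))\<^sup>2 * (cmod (\<mu> \<xi>))\<^sup>2) \<le> L2_norm_sq \<Omega> g"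
    using adj[of y] N_pos[of n] unfolding v y ng by (simp add: field_simps)
  moreover have "(\<Sum>\<xi>\<in>F. (cmod (a \<xi>))\<^sup>2 * \<delta>) \<le> (\<Sum>\<xi>\<in>F. (cmod (a \<xi>))\<^sup>2 * (cmod (\<mu> \<xi>))\<^sup>2)"
    using \<delta>(2)[OF n(1)] n(2) unfolding \<mu>_def by (intro sum_mono mult_left_mono) auto
  from mult_left_mono[OF this, of \<alpha>] have "\<alpha> * \<delta> * (\<Sum>k\<in>F. (cmod (a k))\<^sup>2) \<le> \<alpha> * (\<Sum>\<xi>\<in>F. (cmod (a \<xi>))\<^sup>2 * (cmod (\<mu> \<xi>))\<^sup>2)"
    using \<alpha>(1) by (simp add: sum_distrib_left mult_ac)
  ultimately show ?thesis unfolding f_def by linarith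
qed

lemma riesz_basis:
  assumes "\<forall>k\<ge>1. card (B k) = card (L k)"
  shows "L2_riesz_basis (tower_measure R B) (Lambda R L) expo"
  unfolding L2_riesz_basis_def L2_riesz_sequence_def
proof (intro conjI frame ballI expo_L2)
  let ?M = "tower_measure R B"
  have "L2_norm_sq ?M (\<lambda>x. \<Sum>k\<in>F. a k * expo k x) = L2_norm_sq \<Omega> (\<lambda>\<omega>. \<Sum>k\<in>F. a k * e k \<omega>)" for F a
    using pullback(2)[OF L2_sum[OF L2_cmult[OF expo_L2]]] .
  then show "\<exists>C>0. \<exists>D>0. \<forall>F a. finite F \<longrightarrow> F \<subseteq> Lambda R L \<longrightarrow>
      C * (\<Sum>k\<in>F. (cmod (a k))\<^sup>2) \<le> L2_norm_sq ?M (\<lambda>x. \<Sum>k\<in>F. a k * expo k x) \<and>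
      L2_norm_sq ?M (\<lambda>x. \<Sum>k\<in>F. a k * expo k x) \<le> D * (\<Sum>k\<in>F. (cmod (a k))\<^sup>2)"
    using riesz_upper riesz_lower[OF assms] \<alpha>(1) \<delta>(1) \<kappa>(1)
    by (intro exI[of _ "\<alpha> * \<delta>"] exI[of _ "4 * \<kappa>"] conjI allI impI) auto
qed

end

section \<open>Redundancy\<close>

lemma partial_products_tendsto:
  fixes f :: "nat \<Rightarrow> real"
  assumes "convergent_prod (\<lambda>j. f (Suc j))"
  shows "(\<lambda>n. \<Prod>k=1..n. f k) \<longlonglongrightarrow> (\<Prod>j. f (Suc j))"
proof (rule LIMSEQ_imp_Suc)
  have "(\<Prod>k=1..Suc n. f k) = (\<Prod>i\<le>n. f (Suc i))" for n
    by (rule prod.reindex_bij_witness[of _ Suc "\<lambda>k. k - 1"]) auto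
  then show "(\<lambda>n. \<Prod>k=1..Suc n. f k) \<longlonglongrightarrow> (\<Prod>j. f (Suc j))"
    using convergent_prod_LIMSEQ[OF assms] by simp
qed

lemma partial_products_bounded:
  fixes f :: "nat \<Rightarrow> real"
  assumes "convergent_prod (\<lambda>j. f (Suc j))"
  obtains K where "K > 0" "\<And>n. (\<Prod>k=1..n. f k) \<le> K"
proof -
  have "Bseq (\<lambda>n. \<Prod>k=1..n. f k)"
    using partial_products_tendsto[OF assms] convergentI convergent_imp_Bseq by blast
  then obtain K where "K > 0" "\<And>n. norm (\<Prod>k=1..n. f k) \<le> K" by (auto elim: BseqE)
  then show ?thesis by (intro that[of K]) (auto intro: order_trans[OF abs_ge_self])
qed

text \<open>The partial products need not be monotone, so the bound is obtained from their
  reciprocals, which converge because the limit is nonzero.\<close>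

lemma partial_products_bounded_below:
  fixes f :: "nat \<Rightarrow> real"
  assumes "convergent_prod (\<lambda>j. f (Suc j))" "0 < (\<Prod>j. f (Suc j))" "\<forall>k\<ge>1. 0 < f k"
  obtains c where "c > 0" "\<And>n. c \<le> (\<Prod>k=1..n. f k)"
proof -
  have pos: "0 < (\<Prod>k=1..n. f k)" for n using assms(3) by (intro prod_pos) auto
  have "(\<lambda>n. inverse (\<Prod>k=1..n. f k)) \<longlonglongrightarrow> inverse (\<Prod>j. f (Suc j))"
    using assms(2) by (intro tendsto_inverse partial_products_tendsto assms(1)) auto
  then have "Bseq (\<lambda>n. inverse (\<Prod>k=1..n. f k))" using convergentI convergent_imp_Bseq by blast
  then obtain K where K: "K > 0" "\<And>n. norm (inverse (\<Prod>k=1..n. f k)) \<le> K" by (auto elim: BseqE)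
  show ?thesis
  proof (rule that[of "inverse K"])
    fix n
    have "inverse (\<Prod>k=1..n. f k) \<le> K" using K(2)[of n] by (metis abs_le_D1 real_norm_def)
    moreover have "0 < inverse (\<Prod>k=1..n. f k)" using pos[of n] by simp
    ultimately show "inverse K \<le> (\<Prod>k=1..n. f k)" using le_imp_inverse_le by fastforce
  qed (use K in simp)
qed

lemma Lambda_n_subset: "\<forall>k\<ge>1. L' k \<subseteq> L k \<Longrightarrow> Lambda_n R L' n \<subseteq> Lambda_n R L n"
  unfolding Lambda_n_def by (intro image_mono PiE_mono) auto

text \<open>A real infimum is a lower bound only for sets bounded below. For the outer infimum this
  requires the inner ones to be nonnegative, hence nonempty frequency sets, which the frequency 0
  provides.\<close>

lemma delta_Lambda_le:
  assumes zero: "\<forall>k\<ge>1. 0 \<in> L k" and "n \<ge> 1" "\<xi> \<in> Lambda_n R L n"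
  shows "delta_Lambda R B L \<le> (cmod (fourier (tower_tail R B n) (rvec \<xi>)))\<^sup>2"
proof -
  let ?t = "\<lambda>n \<xi>. (cmod (fourier (tower_tail R B n) (rvec \<xi>)))\<^sup>2"
  have ne: "Lambda_n R L m \<noteq> {}" for m using zero by (auto simp: Lambda_n_def PiE_eq_empty_iff)
  have "delta_Lambda R B L \<le> (INF \<xi>\<in>Lambda_n R L n. ?t n \<xi>)" unfolding delta_Lambda_def
  proof (rule cINF_lower)
    show "bdd_below ((\<lambda>n. INF \<xi>\<in>Lambda_n R L n. ?t n \<xi>) ` {1..})"
      by (rule bdd_belowI2[of _ 0]) (auto intro: cINF_greatest[OF ne])
  qed (use assms in simp)
  also have "\<dots> \<le> ?t n \<xi>"
    by (rule cINF_lower) (use assms in \<open>auto intro: bdd_belowI2[of _ 0]\<close>)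
  finally show ?thesis .
qed

lemma freq_sum_change:
  assumes "j \<in> {1..n}"
  shows "freq_sum R n l = freq_sum R n (l(j := m)) + transpose (cum_mat R (j - 1)) *v (l j - m)"
proof -
  let ?s = "\<Sum>k\<in>{1..n} - {j}. transpose (cum_mat R (k - 1)) *v l k"
  have "freq_sum R n l = transpose (cum_mat R (j - 1)) *v l j + ?s"
    unfolding freq_sum_def using assms by (subst sum.remove[of _ j]) auto
  moreover have "freq_sum R n (l(j := m)) = transpose (cum_mat R (j - 1)) *v m + ?s"
    unfolding freq_sum_def using assms by (subst sum.remove[of _ j]) (auto intro: sum.cong)
  moreover have "transpose (cum_mat R (j - 1)) *v l j
      = transpose (cum_mat R (j - 1)) *v m + transpose (cum_mat R (j - 1)) *v (l j - m)"
    unfolding matrix_vector_right_distrib[symmetric] by (rule arg_cong[where f = "(*v) _"]) simp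
  ultimately show ?thesis by (simp only: ac_simps)
qed

text \<open>Replacing the entry at j by m turns any frequency into a removed one, and the change is
  one of finitely many vectors. So finitely many removed frequencies would leave only finitely many
  frequencies altogether.\<close>

lemma infinite_removed_frequencies:
  assumes zero: "\<forall>k\<ge>1. 0 \<in> L k" and fin: "\<forall>k\<ge>1. finite (L k)"
    and direct: "direct_freqs R L" and inf: "infinite (Lambda R L)"
    and j: "j \<ge> 1" and m: "m \<in> L j" "m \<noteq> 0"
  shows "infinite (Lambda R L - Lambda R (L(j := L j - {m})))"
proof
  let ?L' = "L(j := L j - {m})" and ?L'' = "L(j := {m})"
  let ?\<Lambda> = "Lambda R L - Lambda R ?L'"
  assume "finite ?\<Lambda>"
  have zero': "\<forall>k\<ge>1. 0 \<in> ?L' k" using zero m by auto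
  have "Lambda R L \<subseteq> (\<lambda>(\<mu>, k). \<mu> + transpose (cum_mat R (j - 1)) *v (k - m)) ` (?\<Lambda> \<times> L j)"
  proof
    fix \<nu> assume "\<nu> \<in> Lambda R L"
    then obtain n where n: "n \<ge> 1" "n \<ge> j" "\<nu> \<in> Lambda_n R L n"
      using finite_subset_Lambda[OF zero, of "{\<nu>}" R j] by blast
    then obtain l where l: "l \<in> (\<Pi>\<^sub>E k\<in>{1..n}. L k)" "\<nu> = freq_sum R n l" by (auto simp: Lambda_n_def)
    define \<mu> where "\<mu> = freq_sum R n (l(j := m))"
    have jn: "j \<in> {1..n}" using j n by auto
    have lm: "l(j := m) \<in> (\<Pi>\<^sub>E k\<in>{1..n}. ?L'' k)"
      using l(1) jn by (auto simp: PiE_iff extensional_def)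
    have "(\<Pi>\<^sub>E k\<in>{1..n}. ?L'' k) \<subseteq> (\<Pi>\<^sub>E k\<in>{1..n}. L k)" using m by (intro PiE_mono) auto
    then have "\<mu> \<in> Lambda_n R L n" using lm unfolding \<mu>_def Lambda_n_def by blast
    then have "\<mu> \<in> Lambda R L" using n(1) unfolding Lambda_def by blast
    moreover have "\<mu> \<notin> Lambda R ?L'"
    proof
      assume "\<mu> \<in> Lambda R ?L'"
      then obtain N where N: "N \<ge> 1" "N \<ge> n" "\<mu> \<in> Lambda_n R ?L' N"
        using finite_subset_Lambda[OF zero', of "{\<mu>}" R n] by blast
      then obtain s where s: "s \<in> (\<Pi>\<^sub>E k\<in>{1..N}. ?L' k)" "\<mu> = freq_sum R N s"
        by (auto simp: Lambda_n_def)
      \<comment> \<open>Both representations of \<mu> are brought to the same length N before unique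
        representation is applied. Padding inside \<open>?L''\<close> keeps the entry m at j; it is
        possible because n \<ge> j, so zeros are appended only beyond j.\<close>
      have "\<mu> \<in> Lambda_n R ?L'' n" using lm unfolding \<mu>_def Lambda_n_def by blast
      also have "\<dots> \<subseteq> Lambda_n R ?L'' N" using zero n(2) j N(2) by (intro Lambda_n_mono) auto
      finally obtain t where t: "t \<in> (\<Pi>\<^sub>E k\<in>{1..N}. ?L'' k)" "\<mu> = freq_sum R N t"
        by (auto simp: Lambda_n_def)
      have jN: "j \<in> {1..N}" using jn N by auto
      have "(\<Pi>\<^sub>E k\<in>{1..N}. ?L' k) \<subseteq> (\<Pi>\<^sub>E k\<in>{1..N}. L k)"
        "(\<Pi>\<^sub>E k\<in>{1..N}. ?L'' k) \<subseteq> (\<Pi>\<^sub>E k\<in>{1..N}. L k)"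
        using m by (intro PiE_mono; auto)+
      with s(1) t(1) have "s \<in> (\<Pi>\<^sub>E k\<in>{1..N}. L k)" "t \<in> (\<Pi>\<^sub>E k\<in>{1..N}. L k)" by blast+
      then have "s = t" using direct N(1) s(2) t(2) unfolding direct_freqs_def inj_on_def by metis
      moreover have "s j \<noteq> m" "t j = m" using PiE_mem[OF s(1) jN] PiE_mem[OF t(1) jN] by auto
      ultimately show False by simp
    qed
    moreover have "\<nu> = \<mu> + transpose (cum_mat R (j - 1)) *v (l j - m)"
      unfolding l(2) \<mu>_def by (rule freq_sum_change[OF jn])
    moreover have "l j \<in> L j" using l(1) jn by auto
    ultimately show "\<nu> \<in> (\<lambda>(\<mu>, k). \<mu> + transpose (cum_mat R (j - 1)) *v (k - m)) ` (?\<Lambda> \<times> L j)"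
      by (intro image_eqI[of _ _ "(\<mu>, l j)"]) auto
  qed
  moreover have "finite (L j)" using fin j by blast
  ultimately show False using inf \<open>finite ?\<Lambda>\<close> finite_subset by blast
qed

theorem theorem4p1:
  fixes R :: "nat \<Rightarrow> int ^ 'n::finite ^ 'n"
    and B L :: "nat \<Rightarrow> (int ^ 'n) set"
  assumes tower: "frame_tower R B L"
    and series: "tower_series_converge R B"
    and conv: "\<exists>\<mu>. is_inf_convolution (tower_factors R B 0) \<mu>"
    and no_overlap: "no_overlap R B"
    and delta: "delta_Lambda R B L > 0"
  shows
    "((\<forall>j\<ge>1. card (B j) = card (L j)) \<longrightarrow>
        L2_riesz_basis (tower_measure R B) (Lambda R L) expo) \<and>
     ((\<exists>j\<ge>1. card (B j) < card (L j)) \<longrightarrow>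
        L2_frame (tower_measure R B) (Lambda R L) expo \<and>
        (infinite (Lambda R L) \<and> direct_freqs R L \<longrightarrow>
          (\<exists>\<Lambda>\<^sub>0 \<subseteq> Lambda R L. infinite \<Lambda>\<^sub>0 \<and>
              L2_frame (tower_measure R B) (Lambda R L - \<Lambda>\<^sub>0) expo)))"
proof -
  obtain C D where CD: "\<And>j. j \<ge> 1 \<Longrightarrow> 0 < C j \<and> C j \<le> D j"
      and triple: "\<And>j. j \<ge> 1 \<Longrightarrow> frame_triple (R j) (B j) (L j) (C j) (D j)"
      and convC: "convergent_prod (\<lambda>j. C (Suc j))" "0 < (\<Prod>j. C (Suc j))"
      and convD: "convergent_prod (\<lambda>j. D (Suc j))"
    using tower unfolding frame_tower_def by blast
  obtain \<alpha> where \<alpha>: "\<alpha> > 0" "\<And>n. \<alpha> \<le> (\<Prod>k=1..n. C k)"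
    using partial_products_bounded_below[OF convC] CD by blast
  obtain \<kappa> where \<kappa>: "\<kappa> > 0" "\<And>n. (\<Prod>k=1..n. D k) \<le> \<kappa>"
    using partial_products_bounded[OF convD] by blast
  have fin_B: "finite (B k)" and fin_L: "finite (L k)" and zero_B: "0 \<in> B k" and zero_L: "0 \<in> L k"
    and exp: "expanding (R k)" if "k \<ge> 1" for k
    using triple[OF that] by (auto simp: frame_triple_def)
  have lower: "C k * (\<Sum>b\<in>B k. (cmod (x b))\<^sup>2)
      \<le> (\<Sum>l\<in>L k. (cmod (\<Sum>b\<in>B k. x b * cnj (triple_vec (R k) (B k) l b)))\<^sup>2)"
    and upper: "(\<Sum>l\<in>L k. (cmod (\<Sum>b\<in>B k. x b * cnj (triple_vec (R k) (B k) l b)))\<^sup>2)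
      \<le> D k * (\<Sum>b\<in>B k. (cmod (x b))\<^sup>2)" if "k \<ge> 1" for k x
    using triple[OF that] by (auto simp: frame_triple_def)
  \<comment> \<open>\<open>B 0\<close> is arbitrary; the digit space needs a probability measure at index 0 as well\<close>
  define B' where "B' = B(0 := {0})"
  have B': "B' k = B k" if "k \<ge> 1" for k using that by (simp add: B'_def)
  have tail: "tower_tail R B' n = tower_tail R B n" for n
    unfolding tower_tail_def by (rule arg_cong[where f = inf_convolution]) (simp add: fun_eq_iff tower_factors_def B')
  then have measure: "tower_measure R B' = tower_measure R B" by (simp add: tower_measure_def)
  interpret digit_system R B'
  proof
    show "\<forall>k\<ge>1. invertible (rmat (R k))" using exp expanding_invertible by blast
    show "finite (B' k)" "0 \<in> B' k" for k using fin_B zero_B by (auto simp: B'_def)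
    show "tower_series_converge R B'" using series by (simp add: tower_series_converge_def B')
  qed
  \<comment> \<open>Shrinking the frequency sets preserves the upper bounds, since terms are
    dropped, and the bound on the tail transforms, since \<open>Lambda_n\<close> shrinks too. Only
    the lower bounds have to be supplied anew.\<close>
  have sub: "frame_system R B' L' C' D \<alpha>' \<kappa> (delta_Lambda R B L)"
    if L': "\<forall>k\<ge>1. L' k \<subseteq> L k \<and> 0 \<in> L' k" and C': "\<forall>k\<ge>1. 0 \<le> C' k"
      and low: "\<And>k x. k \<ge> 1 \<Longrightarrow> C' k * (\<Sum>b\<in>B k. (cmod (x b))\<^sup>2)
          \<le> (\<Sum>l\<in>L' k. (cmod (\<Sum>b\<in>B k. x b * cnj (triple_vec (R k) (B k) l b)))\<^sup>2)"
      and \<alpha>': "0 < \<alpha>'" "\<And>n. \<alpha>' \<le> (\<Prod>k=1..n. C' k)" for L' C' \<alpha>'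
  proof
    show "\<forall>k\<ge>1. finite (L' k)" using L' fin_L finite_subset by blast
    show "\<forall>k\<ge>1. 0 \<in> L' k" using L' by blast
    show "\<forall>k\<ge>1. 0 \<le> C' k \<and> 0 \<le> D k" using C' CD by (meson less_imp_le order_trans)
    show "C' k * (\<Sum>b\<in>B' k. (cmod (x b))\<^sup>2)
        \<le> (\<Sum>l\<in>L' k. (cmod (\<Sum>b\<in>B' k. x b * cnj (triple_vec (R k) (B' k) l b)))\<^sup>2)" if "k \<ge> 1" for k x
      using low[OF that] by (simp only: B'[OF that])
    show "(\<Sum>l\<in>L' k. (cmod (\<Sum>b\<in>B' k. x b * cnj (triple_vec (R k) (B' k) l b)))\<^sup>2)
        \<le> D k * (\<Sum>b\<in>B' k. (cmod (x b))\<^sup>2)" if "k \<ge> 1" for k x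
    proof -
      have "(\<Sum>l\<in>L' k. (cmod (\<Sum>b\<in>B k. x b * cnj (triple_vec (R k) (B k) l b)))\<^sup>2)
          \<le> (\<Sum>l\<in>L k. (cmod (\<Sum>b\<in>B k. x b * cnj (triple_vec (R k) (B k) l b)))\<^sup>2)"
        using L' that fin_L[OF that] by (intro sum_mono2) auto
      then show ?thesis using upper[OF that, of x] unfolding B'[OF that] by linarith
    qed
    show "delta_Lambda R B L \<le> (cmod (fourier (tower_tail R B' n) (rvec \<xi>)))\<^sup>2"
      if "n \<ge> 1" "\<xi> \<in> Lambda_n R L' n" for n \<xi>
      unfolding tail using that Lambda_n_subset[of L' L R n] L' zero_L by (intro delta_Lambda_le) auto
  qed (use \<alpha>' \<kappa> delta in auto)
  interpret F: frame_system R B' L C D \<alpha> \<kappa> "delta_Lambda R B L"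
    using CD zero_L lower \<alpha> by (intro sub) (auto intro: less_imp_le)
  have redundant: "\<exists>\<Lambda>\<^sub>0 \<subseteq> Lambda R L. infinite \<Lambda>\<^sub>0 \<and>
      L2_frame (tower_measure R B) (Lambda R L - \<Lambda>\<^sub>0) expo"
    if j: "j \<ge> 1" "card (B j) < card (L j)" and inf: "infinite (Lambda R L)" "direct_freqs R L" for j
  proof -
    \<comment> \<open>The vector of the frequency 0 is nonzero, so the deleted frequency can be
      chosen different from 0 and the thinned set still contains 0.\<close>
    have "triple_vec (R j) (B j) 0 0 \<noteq> 0"
      using fin_B[OF j(1)] zero_B[OF j(1)] by (auto simp: triple_vec_def)
    then obtain m c where m: "m \<in> L j - {0}" and c: "c > 0"
      and cm: "\<And>x. c * (\<Sum>b\<in>B j. (cmod (x b))\<^sup>2)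
        \<le> (\<Sum>l\<in>L j - {m}. (cmod (\<Sum>b\<in>B j. x b * cnj (triple_vec (R j) (B j) l b)))\<^sup>2)"
      using lower_bound_drop_redundant[of "B j" "L j" "C j" 0 "\<lambda>b l. cnj (triple_vec (R j) (B j) l b)" 0]
        fin_B[OF j(1)] fin_L[OF j(1)] zero_B[OF j(1)] zero_L[OF j(1)] j CD lower[OF j(1)] by auto
    \<comment> \<open>The bound c after deletion has no prescribed relation to \<open>C j\<close>.
      It is rewritten as a loss factor r on \<open>C j\<close>, capped at 1 so that \<alpha> * r
      bounds every partial product, including those that stop before j.\<close>
    define r where "r = min 1 (c / C j)"
    have Cj: "C j > 0" using CD j by blast
    have r: "r > 0" "r \<le> 1" "C j * r \<le> c"
      using c Cj by (auto simp: r_def min_def field_simps)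
    let ?L' = "L(j := L j - {m})" and ?C' = "C(j := C j * r)"
    interpret F': frame_system R B' ?L' ?C' D "\<alpha> * r" \<kappa> "delta_Lambda R B L"
    proof (rule sub)
      show "\<forall>k\<ge>1. ?L' k \<subseteq> L k \<and> 0 \<in> ?L' k" using zero_L m by auto
      show "\<forall>k\<ge>1. 0 \<le> ?C' k" using CD r by (auto intro: less_imp_le)
      show "?C' k * (\<Sum>b\<in>B k. (cmod (x b))\<^sup>2)
          \<le> (\<Sum>l\<in>?L' k. (cmod (\<Sum>b\<in>B k. x b * cnj (triple_vec (R k) (B k) l b)))\<^sup>2)"
        if k: "k \<ge> 1" for k x
      proof (cases "k = j")
        case True
        have "C j * r * (\<Sum>b\<in>B j. (cmod (x b))\<^sup>2) \<le> c * (\<Sum>b\<in>B j. (cmod (x b))\<^sup>2)"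
          using r(3) by (intro mult_right_mono sum_nonneg) auto
        with cm[of x] True show ?thesis by simp
      qed (use lower[OF k, of x] in simp)
      show "0 < \<alpha> * r" using \<alpha> r by simp
      show "\<alpha> * r \<le> (\<Prod>k=1..n. ?C' k)" for n
      proof -
        have "?C' k = C k * (if k = j then r else 1)" for k by simp
        then have "(\<Prod>k=1..n. ?C' k) = (\<Prod>k=1..n. C k) * (\<Prod>k=1..n. if k = j then r else 1)"
          by (simp only: prod.distrib)
        also have "(\<Prod>k=1..n. if k = j then r else 1) = (if j \<in> {1..n} then r else 1)"
          by (rule prod.delta) simp
        finally have eq: "(\<Prod>k=1..n. ?C' k) = (\<Prod>k=1..n. C k) * (if j \<in> {1..n} then r else 1)" .
        show ?thesis unfolding eq using \<alpha>(1) \<alpha>(2)[of n] r(1,2) by (intro mult_mono) auto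
      qed
    qed
    have "Lambda R ?L' \<subseteq> Lambda R L"
      unfolding Lambda_def using Lambda_n_subset[of ?L' L R] by (intro UN_mono) auto
    then have "Lambda R L - (Lambda R L - Lambda R ?L') = Lambda R ?L'" by blast
    moreover have "infinite (Lambda R L - Lambda R ?L')"
      using m zero_L fin_L inf j(1) by (intro infinite_removed_frequencies) auto
    ultimately show ?thesis using F'.frame[unfolded measure]
      by (intro exI[of _ "Lambda R L - Lambda R ?L'"]) auto
  qed
  have "\<forall>k\<ge>1. card (B' k) = card (L k)" if "\<forall>j\<ge>1. card (B j) = card (L j)"
    using that by (simp add: B')
  then show ?thesis
    using F.frame[unfolded measure] F.riesz_basis[unfolded measure] redundant by blast
qed

end
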